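(* Let $0<d<\pi/2$, $\mathscr{D}_d=\{\zeta\in\mathbb{C}:|\Im\zeta|<d\}$, $\mathscr{D}_d^{-}=\{\zeta\in\mathscr{D}_d:\Re\zeta<0\}$, $\mathscr{D}_d^{+}=\{\zeta\in\mathscr{D}_d:\Re\zeta\ge0\}$, and $\psi(t)=\sinh[(\pi/2)\sinh t]$. Assume $f$ is analytic on $\psi(\mathscr{D}_d)$ and there are constants $K,\alpha,\beta>0$ such that $|f(z)|\le K|1+z^2|^{-(\alpha+1)/2}$ for all $z\in\psi(\mathscr{D}_d^{-})$ and $|f(z)|\le K|1+z^2|^{-(\beta+1)/2}$ for all $z\in\psi(\mathscr{D}_d^{+})$. Let $\mu=\min\{\alpha,\beta\}$, $\nu=\max\{\alpha,\beta\}$, let $n$ be a positive integer, $h=\log(8dn/\mu)/n$, and let $M=n$, $N=n-\lfloor\log(\beta/\alpha)/h\rfloor$ if $\mu=\alpha$, and $N=n$, $M=n-\lfloor\log(\alpha/\beta)/h\rfloor$ if $\mu=\beta$. Suppose $n\ge \nu e/(8d)$, $Mh\ge x_{\alpha/2}$ and $Nh\ge x_{\beta/2}$. Then \[ \left|\int_{-\infty}^{\infty}f(t)\,dt-h\sum_{k=-M}^{N}f(\psi(kh))\psi'(kh)\right|\le C_1e^{-2\pi dn/\log(8dn/\mu)}, \] with $C_1=\frac{2^{\nu+1}K}{\mu}\left\{\frac{2}{(1-e^{-\pi\mu e/4})\{\cos(\frac{\pi}{2}\sin d)\}^{\nu}\cos d}+e^{\pi\nu/4}\right\}$.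
   Context: For $\gamma>0$, $x_\gamma=\operatorname{arcsinh}\!\left(\frac{\sqrt{1+\sqrt{1-(2\pi\gamma)^2}}}{2\pi\gamma}\right)$ if $0<\gamma<1/(2\pi)$, and $x_\gamma=\operatorname{arcsinh}(1)$ if $\gamma\ge 1/(2\pi)$. $\psi(\cdot)$ of a set denotes its image. *)

theory Defs
  imports "HOL-Analysis.Analysis"
begin

definition psi :: "complex \<Rightarrow> complex" where
  "psi t = sinh (complex_of_real (pi/2) * sinh t)"

definition strip :: "real \<Rightarrow> complex set" where
  "strip d = {z. \<bar>Im z\<bar> < d}"

definition strip_minus :: "real \<Rightarrow> complex set" where
  "strip_minus d = {z \<in> strip d. Re z < 0}"

definition strip_plus :: "real \<Rightarrow> complex set" where
  "strip_plus d = {z \<in> strip d. Re z \<ge> 0}"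

definition xg :: "real \<Rightarrow> real" where
  "xg \<gamma> = (if \<gamma> < 1/(2*pi)
     then arsinh (sqrt (1 + sqrt (1 - (2*pi*\<gamma>)^2)) / (2*pi*\<gamma>))
     else arsinh 1)"

end

theory Submission
  imports Defs "HOL-Complex_Analysis.Complex_Analysis" "HOL-Real_Asymp.Real_Asymp"
begin

text \<open>
  Substituting \<open>t = psi x\<close> turns the integral into that of \<open>g = (f \<circ> psi) * psi'\<close>, which is holomorphic
  on the strip. Integrating \<open>g z / (1 - exp (- 2 * pi * \<i> * z / h))\<close> around a rectangle of height
  \<open>2 * y\<close>, whose residues are the trapezoidal terms, bounds the discretization error by
  \<open>q / (1 - q)\<close> times the integrals of \<open>norm g\<close> over the lines \<open>Im z = \<plusminus>y\<close>, where
  \<open>q = exp (- 2 * pi * y / h)\<close>; then \<open>y\<close> tends to \<open>d\<close>. The estimate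
  \<open>norm (cosh (pi / 2 * sinh (x + \<i> * y))) \<ge> cosh (pi / 2 * sinh x * cos y) * cos (pi / 2 * sin y)\<close>
  reduces those integrals, as well as the truncation error, to the weight
  \<open>a * cosh x * exp (- a * sinh x)\<close>, which has an elementary antiderivative.
\<close>

section \<open>Lower bound for the hyperbolic cosine in the strip\<close>

text \<open>The step size balances two errors. Discretization decays like
  \<open>exp (- 2 * pi * d / h)\<close>. Cutting a side with decay exponent \<gamma> at
  \<open>x0\<close> costs, up to a factor,
  \<open>exp (pi * \<gamma> / 4 * (1 - exp x0 / x0))\<close>; at
  \<open>x0 = ln (8 * d * n / \<gamma>)\<close> the decaying part is
  \<open>exp (- 2 * pi * d * n / x0)\<close>, which is at least as small. The floor in
  \<open>M\<close> or \<open>N\<close> shortens the side of faster decay, yet keeps its end point at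
  or beyond this \<open>x0\<close>. A tail integral would give \<open>exp (- a * sinh x0)\<close>,
  so dividing \<open>exp x0\<close> by \<open>x0\<close> is a concession that costs no rate. It pays
  for the obstacle in the truncation estimate: for small \<open>a\<close> the weight may still
  increase at \<open>x0\<close>, and then its tail sum need not lie below its tail integral. The
  constant \<open>exp (pi * \<nu> / 4)\<close> stems from the remaining \<open>1\<close> in the
  exponent. The other obstacle is the lower bound for \<open>cosh (pi / 2 * sinh z)\<close>: the
  imaginary part \<open>pi / 2 * cosh x * sin y\<close> of its argument is unbounded, so the growth
  of the real part has to outweigh the oscillation uniformly in \<open>x\<close>.\<close>

lemma sinh_le_mult_cosh:
  fixes x :: real
  assumes "0 \<le> x"
  shows "sinh x \<le> x * cosh x"
proof -
  have "0 * cosh 0 - sinh 0 \<le> x * cosh x - sinh x"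
  proof (rule DERIV_nonneg_imp_nondecreasing [OF assms])
    fix t :: real assume "0 \<le> t" "t \<le> x"
    then show "\<exists>y. ((\<lambda>x. x * cosh x - sinh x) has_real_derivative y) (at t) \<and> 0 \<le> y"
      by (intro exI[of _ "t * sinh t"]) (auto intro!: derivative_eq_intros)
  qed
  then show ?thesis by simp
qed

text \<open>These are the first two Taylor terms of \<open>x * coth x\<close>, in a form without
  division. The derivative of the difference reduces to the preceding lemma.\<close>

lemma mult_cosh_le:
  fixes x :: real
  assumes "0 \<le> x"
  shows "x * cosh x \<le> (1 + x\<^sup>2 / 3) * sinh x"
proof -
  have "(1 + 0\<^sup>2 / 3) * sinh 0 - 0 * cosh 0 \<le> (1 + x\<^sup>2 / 3) * sinh x - x * cosh x"
  proof (rule DERIV_nonneg_imp_nondecreasing [OF assms])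
    fix t :: real assume t: "0 \<le> t" "t \<le> x"
    have "((\<lambda>x. (1 + x\<^sup>2 / 3) * sinh x - x * cosh x) has_real_derivative
        (t / 3) * (t * cosh t - sinh t)) (at t)"
      by (auto intro!: derivative_eq_intros simp: field_simps power2_eq_square)
    moreover have "0 \<le> (t / 3) * (t * cosh t - sinh t)"
      using sinh_le_mult_cosh[OF t(1)] t by simp
    ultimately show "\<exists>y. ((\<lambda>x. (1 + x\<^sup>2 / 3) * sinh x - x * cosh x) has_real_derivative y) (at t) \<and> 0 \<le> y"
      by blast
  qed
  then show ?thesis by simp
qed

text \<open>The partial fraction expansion of \<open>tan (pi / 2 * s)\<close> starts with
  \<open>4 / pi * s / (1 - s^2)\<close>, and only half of that term is needed, so crude estimates
  suffice. For small \<open>s\<close>, \<open>tan b \<ge> b\<close> is enough; near the pole the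
  complementary angle \<open>u\<close> is proportional to \<open>1 - s\<close> and cancels
  it.\<close>

lemma cos_half_pi_le_sin_half_pi:
  fixes s :: real
  assumes s: "0 \<le> s" "s < 1"
  shows "cos (pi / 2 * s) * (s / (1 - s\<^sup>2)) \<le> pi / 2 * sin (pi / 2 * s)"
proof (cases "s \<le> 1 / 2")
  case True
  define b where "b = pi / 2 * s"
  have b: "0 \<le> b" "b < pi / 2" using s by (auto simp: b_def)
  have cosb: "0 < cos b" using b by (intro cos_gt_zero_pi) auto
  have "b * cos b \<le> sin b"
  proof -
    have "sin 0 - 0 * cos 0 \<le> sin b - b * cos b"
    proof (rule DERIV_nonneg_imp_nondecreasing [OF b(1)])
      fix t :: real assume "0 \<le> t" "t \<le> b"
      then show "\<exists>y. ((\<lambda>x. sin x - x * cos x) has_real_derivative y) (at t) \<and> 0 \<le> y"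
        using b by (intro exI[of _ "t * sin t"])
          (auto intro!: derivative_eq_intros mult_nonneg_nonneg sin_ge_zero)
    qed
    then show ?thesis by simp
  qed
  have "s\<^sup>2 \<le> (1/2)\<^sup>2" using True s by (intro power_mono) auto
  then have "1 / (1 - s\<^sup>2) \<le> 4 / 3" by (simp add: field_simps)
  moreover have "4 / 3 \<le> (pi / 2)\<^sup>2"
    using power_mono[of 3 pi 2] pi_gt3 by (simp add: power_divide)
  ultimately have "s * (1 / (1 - s\<^sup>2)) \<le> s * (pi / 2)\<^sup>2" using s by (intro mult_left_mono) auto
  then have "cos b * (s / (1 - s\<^sup>2)) \<le> cos b * (pi / 2 * b)"
    using cosb by (intro mult_left_mono) (auto simp: b_def power2_eq_square algebra_simps)
  also have "\<dots> = pi / 2 * (b * cos b)" by simp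
  also have "\<dots> \<le> pi / 2 * sin b" using \<open>b * cos b \<le> sin b\<close> by (intro mult_left_mono) auto
  finally show ?thesis by (simp add: b_def)
next
  case False
  define u where "u = pi / 2 * (1 - s)"
  have u: "0 < u" "u < pi / 4" using s False by (auto simp: u_def)
  have eq: "pi / 2 * s = pi / 2 - u" by (simp add: u_def field_simps)
  have "sin u \<le> u" using u by (intro sin_x_le_x) auto
  have "1 / 2 \<le> cos u"
    using u cos_monotone_0_pi_le[of u "pi / 3"] by (simp add: cos_60)
  have "s / (1 + s) \<le> 1 / 2" using s by (simp add: field_simps)
  have "sin u * (s / (1 - s\<^sup>2)) \<le> u * (s / (1 - s\<^sup>2))"
    using \<open>sin u \<le> u\<close> s by (intro mult_right_mono) (auto simp: abs_square_le_1 power_le_one)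
  also have "\<dots> = pi / 2 * (s / (1 + s))"
  proof -
    have "1 - s\<^sup>2 = (1 - s) * (1 + s)" by (simp add: power2_eq_square algebra_simps)
    then show ?thesis using s by (simp add: u_def)
  qed
  also have "\<dots> \<le> pi / 2 * cos u"
    using \<open>s / (1 + s) \<le> 1 / 2\<close> \<open>1 / 2 \<le> cos u\<close> by (intro mult_left_mono) (linarith, simp)
  finally show ?thesis unfolding eq by (simp add: sin_diff cos_diff)
qed

text \<open>Until the angle \<open>b\<close> reaches \<open>pi / 2\<close>, the quotient of the two
  factors that depend on \<open>x\<close> decreases from its value at 0. The sign of its derivative
  compares \<open>a * coth a\<close> with a multiple of \<open>tan b\<close>, for which the two
  preceding lemmas give an upper and a lower bound.\<close>

lemma sin_half_pi_cosh_le_aux: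
  fixes x y :: real
  assumes y: "0 < y" "y < pi / 2" and x: "0 \<le> x" and le1: "cosh x * sin y \<le> 1"
  shows "sin (pi / 2 * (cosh x * sin y)) \<le> cosh (pi / 2 * (sinh x * cos y)) * sin (pi / 2 * sin y)"
proof -
  define a where "a = (\<lambda>t. pi / 2 * (sinh t * cos y))"
  define b where "b = (\<lambda>t. pi / 2 * (cosh t * sin y))"
  have siny: "0 < sin y" and cosy: "0 < cos y" using y by (auto intro: sin_gt_zero cos_gt_zero)
  have "sin (b x) / cosh (a x) \<le> sin (b 0) / cosh (a 0)"
  proof (rule DERIV_nonpos_imp_nonincreasing [OF x])
    fix t :: real assume t: "0 \<le> t" "t \<le> x"
    define D where "D = pi / 2 * (sinh t * sin y * cos (b t) * cosh (a t)
          - cosh t * cos y * sin (b t) * sinh (a t)) / (cosh (a t))\<^sup>2"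
    have "((\<lambda>x. sin (b x) / cosh (a x)) has_real_derivative D) (at t)"
      unfolding a_def b_def D_def
      by (auto intro!: derivative_eq_intros simp: power2_eq_square algebra_simps)
    moreover have "D \<le> 0"
    proof -
      define s where "s = cosh t * sin y"
      have s0: "0 < s" using siny by (simp add: s_def)
      have s1: "s \<le> 1"
      proof -
        have "cosh t \<le> cosh x" using t by (simp add: cosh_real_nonneg_le_iff)
        then have "s \<le> cosh x * sin y" using siny by (simp add: s_def)
        with le1 show ?thesis by simp
      qed
      have b: "b t = pi / 2 * s" by (simp add: b_def s_def)
      have at: "0 \<le> a t" using t cosy by (simp add: a_def)
      have bt: "0 \<le> b t" "b t \<le> pi / 2" using s0 s1 by (auto simp: b)
      have sinb: "0 \<le> sin (b t)" using bt by (intro sin_ge_zero) auto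
      have cosb: "0 \<le> cos (b t)" using bt by (intro cos_ge_zero) auto
      have "sinh t * sin y * cos (b t) * cosh (a t) \<le> cosh t * cos y * sin (b t) * sinh (a t)"
      \<comment> \<open>At \<open>s = 1\<close> the cosine vanishes and the claim is trivial,
        whereas the tangent bound divides by \<open>1 - s^2\<close>.\<close>
      proof (cases "s = 1")
        case True
        then show ?thesis using at cosy sinb by (simp add: b)
      next
        case False
        then have "s < 1" using s1 by simp
        define p where "p = (cos y)\<^sup>2"
        define q where "q = (sinh t)\<^sup>2"
        have p: "0 < p" "p \<le> 1" using cosy by (auto simp: p_def power_le_one)
        have q: "0 \<le> q" by (simp add: q_def)
        have s2: "s\<^sup>2 = (1 + q) * (1 - p)"
          by (simp add: s_def power_mult_distrib cosh_square_eq p_def q_def sin_squared_eq algebra_simps)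
        have ps: "0 < 1 - s\<^sup>2" using \<open>s < 1\<close> s0 by (simp add: power_less_one_iff)
        \<comment> \<open>Indeed \<open>1 - s^2 = p - q * (1 - p)\<close>.\<close>
        have "1 - s\<^sup>2 \<le> p" using p q by (simp add: s2 algebra_simps mult_left_le_one_le)
        have "(1 + q * p) * (1 - s\<^sup>2) \<le> (1 + q) * p"
          using \<open>1 - s\<^sup>2 \<le> p\<close> p q ps by (intro mult_mono) (auto simp: mult_left_le)
        then have key: "1 + q * p \<le> (1 + q) * p / (1 - s\<^sup>2)" using ps by (simp add: field_simps)
        \<comment> \<open>The Taylor coefficient 1/3 and the factor \<open>(pi / 2)^2\<close> in
          \<open>a^2\<close> combine to \<open>pi^2 / 12\<close>, which has to be at most 1.\<close>
        have pi2: "pi\<^sup>2 \<le> 12"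
        proof -
          have "pi < 3.2" using pi_approx by simp
          then have "pi\<^sup>2 \<le> 3.2\<^sup>2" by (intro power_mono) auto
          then show ?thesis by (simp add: power2_eq_square)
        qed
        have "(a t)\<^sup>2 / 3 = pi\<^sup>2 / 12 * (q * p)"
          by (simp add: a_def q_def p_def power_mult_distrib power_divide)
        also have "\<dots> \<le> 1 * (q * p)" using pi2 p q by (intro mult_right_mono) auto
        finally have a2: "(a t)\<^sup>2 / 3 \<le> q * p" by simp
        have "a t * cosh (a t) \<le> (1 + (a t)\<^sup>2 / 3) * sinh (a t)" by (rule mult_cosh_le[OF at])
        also have "\<dots> \<le> (1 + q * p) * sinh (a t)" using a2 at by (intro mult_right_mono) auto
        also have "\<dots> \<le> (1 + q) * p / (1 - s\<^sup>2) * sinh (a t)" using key at by (intro mult_right_mono) auto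
        finally have A: "a t * cosh (a t) \<le> (1 + q) * p / (1 - s\<^sup>2) * sinh (a t)" .
        have B: "cos (b t) * (s / (1 - s\<^sup>2)) \<le> pi / 2 * sin (b t)"
          unfolding b using s0 \<open>s < 1\<close> by (intro cos_half_pi_le_sin_half_pi) auto
        have "pi / 2 * cos y * (sinh t * sin y * cos (b t) * cosh (a t)) = sin y * cos (b t) * (a t * cosh (a t))"
          by (simp add: a_def)
        also have "\<dots> \<le> sin y * cos (b t) * ((1 + q) * p / (1 - s\<^sup>2) * sinh (a t))"
          using A siny cosb by (intro mult_left_mono) auto
        also have "\<dots> = cosh t * p * sinh (a t) * (cos (b t) * (s / (1 - s\<^sup>2)))"
        proof -
          have "1 + q = cosh t * cosh t" by (simp add: q_def cosh_square_eq flip: power2_eq_square)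
          then show ?thesis by (simp add: s_def)
        qed
        also have "\<dots> \<le> cosh t * p * sinh (a t) * (pi / 2 * sin (b t))"
          using B p at by (intro mult_left_mono) auto
        also have "\<dots> = pi / 2 * cos y * (cosh t * cos y * sin (b t) * sinh (a t))"
          by (simp add: p_def power2_eq_square)
        finally show ?thesis using cosy by (simp add: mult_le_cancel_left_pos)
      qed
      then show ?thesis unfolding D_def by (simp add: divide_nonpos_nonneg mult_nonneg_nonpos)
    qed
    ultimately show "\<exists>y. ((\<lambda>x. sin (b x) / cosh (a x)) has_real_derivative y) (at t) \<and> y \<le> 0"
      by blast
  qed
  then show ?thesis by (simp add: a_def b_def field_simps)
qed

lemma abs_sin_half_pi_cosh_le:
  fixes x y :: real
  assumes y: "0 < y" "y < pi / 2" and x: "0 \<le> x"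
  shows "\<bar>sin (pi / 2 * (cosh x * sin y))\<bar> \<le> cosh (pi / 2 * (sinh x * cos y)) * sin (pi / 2 * sin y)"
proof -
  have siny: "0 < sin y" and cosy: "0 < cos y" using y by (auto intro: sin_gt_zero cos_gt_zero)
  show ?thesis
  proof (cases "cosh x * sin y \<le> 1")
    case True
    have "pi / 2 * (cosh x * sin y) \<le> pi" using True pi_gt_zero by simp
    then have "0 \<le> sin (pi / 2 * (cosh x * sin y))" using siny by (intro sin_ge_zero) auto
    with sin_half_pi_cosh_le_aux[OF y x True] show ?thesis by simp
  next
    case False
    \<comment> \<open>Here the angle is exactly \<open>pi / 2\<close> and the sine equals 1. Beyond
      \<open>t\<close> the left side stays at most 1 while the right side keeps growing, so the
      bound at \<open>t\<close> carries over to \<open>x\<close>.\<close>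
    define t where "t = arcosh (1 / sin y)"
    have ge1: "1 / sin y \<ge> 1" using siny by simp
    have cosht: "cosh t = 1 / sin y" using ge1 by (simp add: t_def)
    have t0: "0 \<le> t" using ge1 by (simp add: t_def arcosh_nonneg_real)
    have "cosh t \<le> cosh x" using False siny by (simp add: cosht field_simps)
    then have tx: "t \<le> x" using t0 x by (simp add: cosh_real_nonneg_le_iff)
    have sc: "0 \<le> sin (pi / 2 * sin y)"
    proof (intro sin_ge_zero)
      have "pi / 2 * sin y \<le> pi / 2 * 1" by (intro mult_left_mono) auto
      then show "pi / 2 * sin y \<le> pi" using pi_gt_zero by linarith
    qed (use siny in auto)
    have "\<bar>sin (pi / 2 * (cosh x * sin y))\<bar> \<le> 1" by simp
    also have "1 \<le> cosh (pi / 2 * (sinh t * cos y)) * sin (pi / 2 * sin y)"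
      using sin_half_pi_cosh_le_aux[OF y t0] siny by (simp add: cosht)
    also have "\<dots> \<le> cosh (pi / 2 * (sinh x * cos y)) * sin (pi / 2 * sin y)"
      using sc tx t0 x cosy by (intro mult_right_mono) (auto simp: cosh_real_nonneg_le_iff)
    finally show ?thesis .
  qed
qed

lemma norm_cosh_squared:
  "(norm (cosh z))\<^sup>2 = (cosh (Re z))\<^sup>2 - (sin (Im z))\<^sup>2" for z :: complex
proof -
  have "Re (cosh z) = cosh (Re z) * cos (Im z)" "Im (cosh z) = sinh (Re z) * sin (Im z)"
    by (simp_all add: cosh_field_def sinh_field_def Re_exp Im_exp algebra_simps add_divide_distrib diff_divide_distrib)
  then show ?thesis
    by (simp add: cmod_power2 power_mult_distrib sinh_square_eq cos_squared_eq algebra_simps)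
qed

lemma Re_sinh: "Re (sinh z) = sinh (Re z) * cos (Im z)"
  and Im_sinh: "Im (sinh z) = cosh (Re z) * sin (Im z)"
  by (simp_all add: cosh_field_def sinh_field_def Re_exp Im_exp algebra_simps add_divide_distrib diff_divide_distrib)

text \<open>In \<open>cosh^2 - sin^2\<close> for the squared modulus, the subtracted sine is at most
  \<open>A * sin (pi / 2 * sin y)\<close>, which leaves \<open>A\<close> times the cosine of the
  same angle. Equality holds on the imaginary axis, so the cosine factor cannot be improved
  there.\<close>

lemma norm_cosh_half_pi_sinh_ge:
  fixes z :: complex
  assumes "\<bar>Im z\<bar> < pi / 2"
  shows "cosh (pi / 2 * (sinh (Re z) * cos (Im z))) * cos (pi / 2 * sin (Im z))
           \<le> norm (cosh (of_real (pi / 2) * sinh z))"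
proof -
  define x y where "x = Re z" and "y = Im z"
  have y: "\<bar>y\<bar> < pi / 2" using assms by (simp add: y_def)
  define A where "A = cosh (pi / 2 * (sinh x * cos y))"
  have abs_ineq: "\<bar>sin (pi / 2 * (cosh x * sin y))\<bar> \<le> A * \<bar>sin (pi / 2 * sin y)\<bar>"
  proof -
    have main: "\<bar>sin (pi / 2 * (cosh x * sin y))\<bar> \<le> cosh (pi / 2 * (sinh x * cos y)) * \<bar>sin (pi / 2 * sin y)\<bar>"
      if "0 \<le> y" "y < pi / 2" "0 \<le> x" for x y :: real
    proof (cases "y = 0")
      case False
      have "\<bar>sin (pi / 2 * (cosh x * sin y))\<bar> \<le> cosh (pi / 2 * (sinh x * cos y)) * sin (pi / 2 * sin y)"
        using that False by (intro abs_sin_half_pi_cosh_le) auto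
      also have "\<dots> \<le> cosh (pi / 2 * (sinh x * cos y)) * \<bar>sin (pi / 2 * sin y)\<bar>"
        by (intro mult_left_mono) auto
      finally show ?thesis .
    qed auto
    have "\<bar>sin (pi / 2 * (cosh \<bar>x\<bar> * sin \<bar>y\<bar>))\<bar> \<le> cosh (pi / 2 * (sinh \<bar>x\<bar> * cos \<bar>y\<bar>)) * \<bar>sin (pi / 2 * sin \<bar>y\<bar>)\<bar>"
      using y by (intro main) auto
    then show ?thesis by (cases "0 \<le> x"; cases "0 \<le> y") (auto simp: A_def)
  qed
  have "(A * cos (pi / 2 * sin y))\<^sup>2 = A\<^sup>2 - (A * \<bar>sin (pi / 2 * sin y)\<bar>)\<^sup>2"
    by (simp add: power_mult_distrib cos_squared_eq algebra_simps)
  also have "\<dots> \<le> A\<^sup>2 - \<bar>sin (pi / 2 * (cosh x * sin y))\<bar>\<^sup>2"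
    using power_mono[OF abs_ineq, of 2] by simp
  also have "\<dots> = (norm (cosh (of_real (pi / 2) * sinh z)))\<^sup>2"
    by (simp add: norm_cosh_squared Re_sinh Im_sinh A_def x_def y_def)
  finally show ?thesis
    unfolding A_def x_def y_def by (rule power2_le_imp_le) simp
qed

lemma norm_cosh_le: "norm (cosh z) \<le> cosh (Re z)" for z :: complex
  by (rule power2_le_imp_le) (simp_all add: norm_cosh_squared)

section \<open>Tail sums of the double exponential weight\<close>

definition de_weight :: "real \<Rightarrow> real \<Rightarrow> real" where
  "de_weight a x = a * cosh x * exp (- (a * sinh x))"

lemma de_weight_nonneg: "0 \<le> a \<Longrightarrow> 0 \<le> de_weight a x"
  by (simp add: de_weight_def)

lemma DERIV_exp_neg_sinh:
  "((\<lambda>x. - exp (- (a * sinh x))) has_real_derivative de_weight a x) (at x within A)"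
  unfolding de_weight_def by (auto intro!: derivative_eq_intros)

text \<open>The sign is that of a quadratic in \<open>sinh x\<close> with discriminant
  \<open>1 - 4 * a^2\<close>. For \<open>2 * a \<ge> 1\<close> the weight never increases; for
  smaller positive \<open>a\<close> it has a minimum and then a maximum, where \<open>sinh x\<close>
  is the smaller and the larger root.\<close>

lemma DERIV_de_weight:
  "(de_weight a has_real_derivative a * exp (- (a * sinh x)) * (sinh x - a * (cosh x)\<^sup>2)) (at x)"
  unfolding de_weight_def by (auto intro!: derivative_eq_intros simp: algebra_simps power2_eq_square)

lemma de_weight_antimono:
  assumes "0 \<le> a" "x \<le> y" and ge: "\<And>t. x \<le> t \<Longrightarrow> t \<le> y \<Longrightarrow> sinh t \<le> a * (cosh t)\<^sup>2"
  shows "de_weight a y \<le> de_weight a x"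
proof (rule DERIV_nonpos_imp_nonincreasing [OF assms(2)])
  fix t assume "x \<le> t" "t \<le> y"
  then have "a * exp (- (a * sinh t)) * (sinh t - a * (cosh t)\<^sup>2) \<le> 0"
    using ge[of t] assms(1) by (intro mult_nonneg_nonpos) auto
  then show "\<exists>D. (de_weight a has_real_derivative D) (at t) \<and> D \<le> 0"
    using DERIV_de_weight by blast
qed

lemma de_weight_mono:
  assumes "0 \<le> a" "x \<le> y" and ge: "\<And>t. x \<le> t \<Longrightarrow> t \<le> y \<Longrightarrow> a * (cosh t)\<^sup>2 \<le> sinh t"
  shows "de_weight a x \<le> de_weight a y"
proof (rule DERIV_nonneg_imp_nondecreasing [OF assms(2)])
  fix t assume "x \<le> t" "t \<le> y"
  then have "a * exp (- (a * sinh t)) * (sinh t - a * (cosh t)\<^sup>2) \<ge> 0"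
    using ge[of t] assms(1) by (intro mult_nonneg_nonneg) auto
  then show "\<exists>D. (de_weight a has_real_derivative D) (at t) \<and> 0 \<le> D"
    using DERIV_de_weight by blast
qed

text \<open>A convex potential whose slope dominates the weight from the right turns the tail sum into a
  telescoping one.\<close>

lemma sum_le_potential:
  fixes F \<Phi> :: "real \<Rightarrow> real"
  assumes h: "0 < h" and step: "\<And>x y. x0 \<le> x \<Longrightarrow> x \<le> y \<Longrightarrow> (y - x) * F y \<le> \<Phi> x - \<Phi> y"
    and pos: "\<And>x. x0 \<le> x \<Longrightarrow> 0 \<le> \<Phi> x"
  shows "h * (\<Sum>k<m. F (x0 + real (Suc k) * h)) \<le> \<Phi> x0"
proof -
  have "h * (\<Sum>k<m. F (x0 + real (Suc k) * h)) = (\<Sum>k<m. h * F (x0 + real (Suc k) * h))"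
    by (simp add: sum_distrib_left)
  also have "\<dots> \<le> (\<Sum>k<m. \<Phi> (x0 + real k * h) - \<Phi> (x0 + real (Suc k) * h))"
  proof (rule sum_mono)
    fix k :: nat
    show "h * F (x0 + real (Suc k) * h) \<le> \<Phi> (x0 + real k * h) - \<Phi> (x0 + real (Suc k) * h)"
      using step[of "x0 + real k * h" "x0 + real (Suc k) * h"] h
      by (simp add: algebra_simps)
  qed
  also have "\<dots> = \<Phi> x0 - \<Phi> (x0 + real m * h)"
    by (subst sum_lessThan_telescope') simp
  also have "\<dots> \<le> \<Phi> x0" using pos[of "x0 + real m * h"] h by simp
  finally show ?thesis .
qed

text \<open>The mean value theorem for the antiderivative; it suffices that the weight is lowest at
  the right end point of the step.\<close>

lemma de_weight_step:
  assumes a: "0 \<le> a" and "x \<le> y" and ge: "\<And>t. x \<le> t \<Longrightarrow> t \<le> y \<Longrightarrow> de_weight a y \<le> de_weight a t"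
  shows "(y - x) * de_weight a y \<le> exp (- (a * sinh x)) - exp (- (a * sinh y))"
proof (cases "x = y")
  case False
  then have "x < y" using assms by simp
  then obtain z where z: "x < z" "z < y"
    "(- exp (- (a * sinh y))) - (- exp (- (a * sinh x))) = (y - x) * de_weight a z"
    using MVT2[of x y "\<lambda>x. - exp (- (a * sinh x))" "de_weight a"] DERIV_exp_neg_sinh by blast
  then have "(y - x) * de_weight a y \<le> (y - x) * de_weight a z"
    using ge[of z] \<open>x < y\<close> by (intro mult_left_mono) auto
  then show ?thesis using z by simp
qed auto


text \<open>By Vieta the roots of \<open>a * s^2 - s + a\<close> have product 1. Since
  \<open>sinh x1 \<ge> 1\<close> is one of them, the other is at most 1, and on
  \<open>s \<ge> 1\<close> the sign changes only at \<open>sinh x1\<close>. The proof factors the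
  quadratic accordingly.\<close>

lemma
  fixes a :: real
  assumes a: "0 < a" and x1: "a * (cosh x1)\<^sup>2 = sinh x1" and s1: "1 \<le> sinh x1"
  shows sinh_le_mult_cosh_sq_right: "x1 \<le> t \<Longrightarrow> sinh t \<le> a * (cosh t)\<^sup>2"
    and mult_cosh_sq_le_sinh_left: "t \<le> x1 \<Longrightarrow> 1 \<le> sinh t \<Longrightarrow> a * (cosh t)\<^sup>2 \<le> sinh t"
proof -
  have factor: "a * (cosh t)\<^sup>2 - sinh t = (sinh t - sinh x1) * (a * sinh t - 1 + a * sinh x1)" for t
    using x1 unfolding cosh_square_eq by (simp add: algebra_simps power2_eq_square)
  have a1: "1 \<le> a * (sinh x1 + 1)"
  proof -
    have "a \<le> a * sinh x1" using s1 a by simp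
    moreover have "a * (sinh x1)\<^sup>2 + a = sinh x1" using x1 by (simp add: cosh_square_eq algebra_simps)
    ultimately have "sinh x1 * 1 \<le> sinh x1 * (a * (sinh x1 + 1))"
      by (simp add: algebra_simps power2_eq_square)
    moreover have "0 < sinh x1" using s1 by linarith
    ultimately show ?thesis using mult_le_cancel_left_pos by blast
  qed
  have aux: "0 \<le> a * sinh t - 1 + a * sinh x1" if "1 \<le> sinh t" for t
  proof -
    have "a * 1 \<le> a * sinh t" using that a by (intro mult_left_mono) auto
    then show ?thesis using a1 by (simp add: algebra_simps)
  qed
  show "sinh t \<le> a * (cosh t)\<^sup>2" if "x1 \<le> t"
  proof -
    have le: "sinh x1 \<le> sinh t" using that by simp
    have "0 \<le> (sinh t - sinh x1) * (a * sinh t - 1 + a * sinh x1)"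
      using le s1 by (intro mult_nonneg_nonneg aux) linarith+
    then show ?thesis using factor[of t] by simp
  qed
  show "a * (cosh t)\<^sup>2 \<le> sinh t" if "t \<le> x1" "1 \<le> sinh t"
  proof -
    have "sinh t \<le> sinh x1" using that by simp
    then have "(sinh t - sinh x1) * (a * sinh t - 1 + a * sinh x1) \<le> 0"
      using aux[of t] that by (intro mult_nonpos_nonneg) auto
    then show ?thesis using factor[of t] by simp
  qed
qed

text \<open>Left of the peak \<open>x1\<close> the weight at the right end of a step may exceed its
  mean over the step. There it is replaced by its maximal value, so the potential is continued to
  the left by its tangent at \<open>x1\<close>; this produces the linear factor in the
  bound.\<close>

lemma sum_de_weight_le_peak:
  assumes a: "0 < a" and h: "0 < h" and x01: "x0 \<le> x1" and x0: "1 \<le> sinh x0"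
    and x1: "a * (cosh x1)\<^sup>2 = sinh x1"
  shows "h * (\<Sum>k<m. de_weight a (x0 + real (Suc k) * h))
           \<le> exp (- (a * sinh x1)) * (1 + (x1 - x0) * (a * cosh x1))"
proof -
  define \<Phi> where "\<Phi> = (\<lambda>x. if x1 \<le> x then exp (- (a * sinh x))
                            else exp (- (a * sinh x1)) + (x1 - x) * de_weight a x1)"
  have s1: "1 \<le> sinh x1" using x0 x01 sinh_real_le_iff[of x0 x1] by linarith
  note dec = sinh_le_mult_cosh_sq_right[OF a x1 s1]
  have inc: "a * (cosh t)\<^sup>2 \<le> sinh t" if "x0 \<le> t" "t \<le> x1" for t
  proof (rule mult_cosh_sq_le_sinh_left[OF a x1 s1 that(2)])
    show "1 \<le> sinh t" using x0 that(1) sinh_real_le_iff[of x0 t] by linarith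
  qed
  have right: "(y - x) * de_weight a y \<le> exp (- (a * sinh x)) - exp (- (a * sinh y))"
    if "x1 \<le> x" "x \<le> y" for x y
    using that a dec by (intro de_weight_step de_weight_antimono) auto
  have left: "de_weight a y \<le> de_weight a x1" if "x0 \<le> y" for y
  proof (cases "y \<le> x1")
    case True
    then show ?thesis using that a inc by (intro de_weight_mono) auto
  next
    case False
    then show ?thesis using a dec by (intro de_weight_antimono) auto
  qed
  have "h * (\<Sum>k<m. de_weight a (x0 + real (Suc k) * h)) \<le> \<Phi> x0"
  proof (rule sum_le_potential[OF h])
    fix x y assume xy: "x0 \<le> x" "x \<le> y"
    consider "x1 \<le> x" | "x < x1" "y \<le> x1" | "x < x1" "x1 < y" by linarith
    then show "(y - x) * de_weight a y \<le> \<Phi> x - \<Phi> y"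
    proof cases
      case 1
      then show ?thesis using right[OF 1 xy(2)] xy by (simp add: \<Phi>_def)
    next
      case 2
      have "\<Phi> x - \<Phi> y = (y - x) * de_weight a x1"
        using 2 by (cases "y = x1") (auto simp: \<Phi>_def algebra_simps)
      moreover have "(y - x) * de_weight a y \<le> (y - x) * de_weight a x1"
        using xy by (intro mult_left_mono left) auto
      ultimately show ?thesis by simp
    next
      \<comment> \<open>A step across the peak is split at \<open>x1\<close>, but both parts use the
        weight at the same point \<open>y\<close>: the left part bounds it by the maximum, the right
        part by the integral.\<close>
      case 3
      have "(y - x) * de_weight a y = (x1 - x) * de_weight a y + (y - x1) * de_weight a y"
        by (simp add: algebra_simps)
      also have "\<dots> \<le> (x1 - x) * de_weight a x1 + (exp (- (a * sinh x1)) - exp (- (a * sinh y)))"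
        using 3 xy by (intro add_mono mult_left_mono left right) auto
      also have "\<dots> = \<Phi> x - \<Phi> y" using 3 by (simp add: \<Phi>_def)
      finally show ?thesis .
    qed
  next
    fix x
    show "0 \<le> \<Phi> x" using a by (auto simp: \<Phi>_def intro!: add_nonneg_nonneg mult_nonneg_nonneg de_weight_nonneg)
  qed
  also have "\<Phi> x0 = exp (- (a * sinh x1)) * (1 + (x1 - x0) * (a * cosh x1))"
    using x01 by (cases "x0 = x1") (auto simp: \<Phi>_def de_weight_def algebra_simps)
  finally show ?thesis .
qed

lemma sum_de_weight_le_antimono:
  assumes a: "0 < a" and h: "0 < h" and dec: "\<And>t. x0 \<le> t \<Longrightarrow> sinh t \<le> a * (cosh t)\<^sup>2"
  shows "h * (\<Sum>k<m. de_weight a (x0 + real (Suc k) * h)) \<le> exp (- (a * sinh x0))"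
proof (rule sum_le_potential[OF h])
  fix x y assume "x0 \<le> x" "x \<le> y"
  then show "(y - x) * de_weight a y \<le> exp (- (a * sinh x)) - exp (- (a * sinh y))"
    using a dec by (intro de_weight_step de_weight_antimono) auto
qed simp

text \<open>The right side is, per unit of \<open>a\<close>, what the exponent gains when
  \<open>- a * sinh x\<close> is weakened to \<open>a / 2 * (1 - exp x / x)\<close>. The constant
  18/100 is slightly above \<open>(sqrt 2 - 1)^2\<close>, the loss to be covered. For
  \<open>x \<ge> 5 / 4\<close> the term \<open>w\<close> suffices; near 1, where \<open>w\<close>
  vanishes, the term \<open>1 - q\<close> does.\<close>

lemma sinh_le_slack:
  fixes x :: real
  assumes "1 \<le> x"
  shows "18 / 100 * sinh x \<le> (exp x * (1 - 1 / x) + 1 - exp (- x)) / 2"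
proof -
  define p q w where "p = exp x" and "q = exp (- x)" and "w = exp x * (1 - 1 / x)"
  have pq: "0 < p" "0 < q" "q \<le> 1" "p * q = 1"
    using assms by (auto simp: p_def q_def simp flip: exp_add)
  have "18 / 100 * (p - q) \<le> w + 1 - q"
  proof (cases "5 / 4 \<le> x")
    case True
    then have "1 / 5 \<le> 1 - 1 / x" by (simp add: field_simps)
    then have "p * (1 / 5) \<le> w" unfolding w_def p_def by (intro mult_left_mono) auto
    then show ?thesis using pq(1-3) by (simp add: field_simps)
  next
    case False
    have "p \<le> exp (1 + 1 / 4)" using False by (simp add: p_def)
    also have "\<dots> = exp 1 * exp (1 / 4 :: real)" by (rule exp_add)
    also have "\<dots> \<le> 2.72 * (1 + 1 / 4 + (1 / 4)\<^sup>2)"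
      using e_less_272 exp_bound[of "1/4 :: real"] by (intro mult_mono) auto
    also have "\<dots> \<le> 4" by (simp add: power2_eq_square)
    finally have "p \<le> 4" .
    have "p - q = (1 + p) * (1 - q)" using pq(4) by (simp add: algebra_simps)
    also have "\<dots> \<le> 5 * (1 - q)" using \<open>p \<le> 4\<close> pq by (intro mult_right_mono) auto
    finally have "p - q \<le> 5 * (1 - q)" .
    moreover have "0 \<le> w" using assms by (simp add: w_def)
    ultimately show ?thesis using pq(1-3) by (simp add: field_simps)
  qed
  moreover have "sinh x = (p - q) / 2" by (simp add: sinh_field_def p_def q_def)
  ultimately show ?thesis unfolding w_def[symmetric] q_def[symmetric] by (simp add: field_simps)
qed

text \<open>The threshold \<open>xg\<close> lies to the left of the maximum of the weight when \<open>2 * a < 1\<close>, but by a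
  factor of at most \<open>sqrt 2\<close> in \<open>sinh\<close>. The resulting loss is absorbed by replacing
  \<open>exp (- a * sinh x0)\<close> with the larger \<open>exp (a / 2 * (1 - exp x0 / x0))\<close>.\<close>

lemma sum_de_weight_le:
  assumes a: "0 < a" and h: "0 < h" and x0: "1 \<le> x0" and xg: "xg (a / pi) \<le> x0"
  shows "h * (\<Sum>k<m. de_weight a (x0 + real (Suc k) * h)) \<le> exp (a / 2 * (1 - exp x0 / x0))"
proof -
  define A where "A = (exp x0 * (1 - 1 / x0) + 1 - exp (- x0)) / 2"
  have slack: "18 / 100 * sinh x0 \<le> A" unfolding A_def by (rule sinh_le_slack[OF x0])
  moreover have "0 \<le> sinh x0" using x0 by simp
  ultimately have A0: "0 \<le> A" by linarith
  have expeq: "exp (a / 2 * (1 - exp x0 / x0)) = exp (- (a * sinh x0)) * exp (a * A)"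
  proof -
    have "a / 2 * (1 - exp x0 / x0) = - (a * sinh x0) + a * A"
      unfolding A_def sinh_field_def by (simp add: algebra_simps diff_divide_distrib add_divide_distrib)
    then show ?thesis by (simp only: exp_add)
  qed
  have simple: "h * (\<Sum>k<m. de_weight a (x0 + real (Suc k) * h)) \<le> exp (a / 2 * (1 - exp x0 / x0))"
    if "\<And>t. x0 \<le> t \<Longrightarrow> sinh t \<le> a * (cosh t)\<^sup>2"
  proof -
    have "h * (\<Sum>k<m. de_weight a (x0 + real (Suc k) * h)) \<le> exp (- (a * sinh x0))"
      using a h that by (rule sum_de_weight_le_antimono)
    also have "\<dots> \<le> exp (- (a * sinh x0)) * exp (a * A)" using a A0 by simp
    finally show ?thesis by (simp only: expeq)
  qed
  have s0: "1 \<le> sinh x0" using x0 real_le_x_sinh[of x0] by (simp add: sinh_field_def exp_minus)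
  show ?thesis
  proof (cases "1 \<le> 2 * a")
    case True
    show ?thesis
    proof (rule simple)
      fix t :: real
      have "0 \<le> (sinh t - 1)\<^sup>2" by simp
      \<comment> \<open>AM-GM: \<open>cosh^2 = 1 + sinh^2\<close> is at least
        \<open>2 * sinh\<close>.\<close>
      then have "sinh t \<le> 1 / 2 * (cosh t)\<^sup>2" unfolding cosh_square_eq by (simp add: power2_eq_square algebra_simps)
      also have "\<dots> \<le> a * (cosh t)\<^sup>2" using True by (intro mult_right_mono) auto
      finally show "sinh t \<le> a * (cosh t)\<^sup>2" .
    qed
  next
    case False
    \<comment> \<open>This is \<open>2 * pi * \<gamma>\<close> from the definition of
      \<open>xg\<close> at \<open>\<gamma> = a / pi\<close>. In these terms the peak
      \<open>x1\<close> has \<open>sinh x1 = (1 + r) / c\<close>, the larger root of the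
      quadratic.\<close>
    define c where "c = 2 * a"
    define r where "r = sqrt (1 - c\<^sup>2)"
    define x1 where "x1 = arsinh ((1 + r) / c)"
    have c: "0 < c" "c < 1" using False a by (auto simp: c_def)
    have c2: "c\<^sup>2 < 1" using c by (simp add: power_less_one_iff)
    have r: "0 \<le> r" "r \<le> 1" "r\<^sup>2 = 1 - c\<^sup>2" using c2 by (auto simp: r_def)
    have s1: "sinh x1 = (1 + r) / c" by (simp add: x1_def)
    have x1: "a * (cosh x1)\<^sup>2 = sinh x1"
    proof -
      have sq: "(1 + r)\<^sup>2 = 2 * (1 + r) - c\<^sup>2" using r(3) by (simp add: power2_eq_square algebra_simps)
      have "c / 2 * (((1 + r) / c)\<^sup>2 + 1) = (1 + r) / c"
        unfolding power_divide sq using c by (simp add: field_simps power2_eq_square)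
      moreover have "a = c / 2" by (simp add: c_def)
      ultimately show ?thesis by (simp only: cosh_square_eq s1)
    qed
    have "xg (a / pi) = arsinh (sqrt (1 + r) / c)"
      using c by (simp add: xg_def c_def r_def field_simps)
    then have "sqrt (1 + r) / c \<le> sinh x0" using xg
      by (metis sinh_arsinh_real sinh_real_le_iff)
    then have "sqrt (1 + r) * (sqrt (1 + r) / c) \<le> sqrt 2 * sinh x0"
      using r s0 c by (intro mult_mono) auto
    then have rho: "sinh x1 \<le> sqrt 2 * sinh x0" using r by (simp add: s1)
    show ?thesis
    proof (cases "x1 \<le> x0")
      case True
      have "1 \<le> sinh x1" using c r by (simp add: s1)
      then show ?thesis
        using simple sinh_le_mult_cosh_sq_right[OF a x1] True by auto
    next
      case False
      define \<delta> where "\<delta> = x1 - x0"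
      define \<rho> where "\<rho> = sinh x1 / sinh x0"
      have \<delta>: "0 < \<delta>" using False by (simp add: \<delta>_def)
      have "sinh x0 < sinh x1" using False by simp
      then have \<rho>: "1 \<le> \<rho>" "\<rho> \<le> sqrt 2" "sinh x1 = \<rho> * sinh x0" using rho s0 x0 by (auto simp: \<rho>_def pos_divide_le_eq pos_le_divide_eq)
      have "\<delta> * cosh x0 \<le> sinh x1 - sinh x0"
      proof -
        obtain z where "x0 < z" "z < x1" "sinh x1 - sinh x0 = (x1 - x0) * cosh z"
          using MVT2[of x0 x1 sinh cosh] False has_field_derivative_sinh[OF DERIV_ident] by auto
        moreover have "cosh x0 \<le> cosh z" using calculation x0 by (simp add: cosh_real_nonneg_le_iff)
        ultimately show ?thesis using \<delta> by (simp add: \<delta>_def)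
      qed
      have "cosh x1 \<le> \<rho> * cosh x0"
      proof (rule power2_le_imp_le)
        have "1 \<le> \<rho>\<^sup>2" using \<rho> by simp
        then show "(cosh x1)\<^sup>2 \<le> (\<rho> * cosh x0)\<^sup>2"
          by (simp add: power_mult_distrib cosh_square_eq \<rho>(3) algebra_simps)
      qed (use \<rho> in auto)
      then have "\<delta> * cosh x1 \<le> \<rho> * (\<delta> * cosh x0)" using \<delta> by (simp add: mult.left_commute)
      also have "\<dots> \<le> \<rho> * (sinh x1 - sinh x0)"
        using \<open>\<delta> * cosh x0 \<le> _\<close> \<rho> by (intro mult_left_mono) auto
      \<comment> \<open>The first summand will cancel against the passage from
        \<open>exp (- a * sinh x1)\<close> to \<open>exp (- a * sinh x0)\<close>. Only the
        second-order term in \<open>\<rho> - 1\<close> is a genuine loss.\<close>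
      also have "\<dots> = (sinh x1 - sinh x0) + (\<rho> - 1)\<^sup>2 * sinh x0"
        unfolding \<rho>(3) by (simp add: power2_eq_square algebra_simps)
      also have "(\<rho> - 1)\<^sup>2 * sinh x0 \<le> 18 / 100 * sinh x0"
      proof (rule mult_right_mono)
        have "sqrt 2 \<le> 1.42" by (rule real_le_lsqrt) (auto simp: power2_eq_square)
        then have "(\<rho> - 1)\<^sup>2 \<le> 0.42\<^sup>2" using \<rho> by (intro power_mono) auto
        then show "(\<rho> - 1)\<^sup>2 \<le> 18 / 100" by (simp add: power2_eq_square)
      qed (use x0 in auto)
      finally have "\<delta> * cosh x1 \<le> (sinh x1 - sinh x0) + A" using slack by simp
      then have "a * (\<delta> * cosh x1) \<le> a * ((sinh x1 - sinh x0) + A)" using a by (intro mult_left_mono) auto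
      then have key: "\<delta> * (a * cosh x1) \<le> a * sinh x1 - a * sinh x0 + a * A" by (simp add: algebra_simps)
      have "h * (\<Sum>k<m. de_weight a (x0 + real (Suc k) * h))
              \<le> exp (- (a * sinh x1)) * (1 + \<delta> * (a * cosh x1))"
        unfolding \<delta>_def using a h False s0 x1 by (intro sum_de_weight_le_peak) auto
      also have "\<dots> \<le> exp (- (a * sinh x1)) * exp (\<delta> * (a * cosh x1))"
        by (intro mult_left_mono) (auto simp: exp_ge_add_one_self)
      also have "\<dots> \<le> exp (- (a * sinh x0)) * exp (a * A)"
        unfolding exp_add[symmetric] using key by simp
      finally show ?thesis by (simp only: expeq)
    qed
  qed
qed

section \<open>Trapezoidal sums as residues\<close>

lemma has_contour_integral_linepath_same_Im_iff:
  assumes "a < b"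
  shows "(f has_contour_integral I) (linepath (Complex a c) (Complex b c)) \<longleftrightarrow>
           ((\<lambda>x. f (Complex x c)) has_integral I) {a..b}"
proof -
  have shift: "linepath (Complex a c) (Complex b c) x = linepath (of_real a) (of_real b) x + \<i> * of_real c" for x
    by (simp add: linepath_def complex_eq_iff algebra_simps)
  have diff: "Complex b c - Complex a c = of_real b - of_real a" by (simp add: complex_eq_iff)
  have "(f has_contour_integral I) (linepath (Complex a c) (Complex b c)) \<longleftrightarrow>
          ((\<lambda>z. f (z + \<i> * of_real c)) has_contour_integral I) (linepath (of_real a) (of_real b))"
    unfolding has_contour_integral_linepath shift diff ..
  also have "\<dots> \<longleftrightarrow> ((\<lambda>x. f (of_real x + \<i> * of_real c)) has_integral I) {a..b}"
    using assms by (subst has_contour_integral_linepath_Reals_iff) auto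
  finally show ?thesis by (simp add: Complex_eq)
qed

text \<open>A uniform bound times the length would grow with the width of the rectangle; an
  integrable majorant keeps the horizontal edges bounded in the limit.\<close>

lemma norm_contour_integral_same_Im_le:
  assumes ab: "a < b" and cont: "continuous_on (closed_segment (Complex a c) (Complex b c)) f"
    and B: "\<And>x. a \<le> x \<Longrightarrow> x \<le> b \<Longrightarrow> norm (f (Complex x c)) \<le> B x" and J: "(B has_integral J) {a..b}"
  shows "norm (contour_integral (linepath (Complex a c) (Complex b c)) f) \<le> J"
proof -
  have "(f has_contour_integral contour_integral (linepath (Complex a c) (Complex b c)) f)
          (linepath (Complex a c) (Complex b c))"
    by (intro has_contour_integral_integral contour_integrable_continuous_linepath cont)
  then have I: "((\<lambda>x. f (Complex x c)) has_integral
      contour_integral (linepath (Complex a c) (Complex b c)) f) {a..b}"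
    using has_contour_integral_linepath_same_Im_iff[OF ab] by blast
  show ?thesis
    using integral_norm_bound_integral[OF has_integral_integrable[OF I] has_integral_integrable[OF J]] B
      integral_unique[OF I] integral_unique[OF J] by simp
qed

text \<open>Opposite edges are oriented alike, left to right and bottom to top, so that integrals
  over horizontal lines can be compared directly.\<close>

lemma contour_integral_rectpath:
  assumes "continuous_on (path_image (rectpath a1 a3)) f"
  defines "a2 \<equiv> Complex (Re a3) (Im a1)" and "a4 \<equiv> Complex (Re a1) (Im a3)"
  shows "contour_integral (rectpath a1 a3) f =
    contour_integral (linepath a1 a2) f + contour_integral (linepath a2 a3) f
    - contour_integral (linepath a4 a3) f - contour_integral (linepath a1 a4) f"
proof -
  have "path_image (rectpath a1 a3) = closed_segment a1 a2 \<union> closed_segment a2 a3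
          \<union> closed_segment a3 a4 \<union> closed_segment a4 a1"
    by (simp add: rectpath_def Let_def path_image_join a2_def a4_def Un_assoc)
  then have int: "f contour_integrable_on linepath a1 a2" "f contour_integrable_on linepath a2 a3"
    "f contour_integrable_on linepath a3 a4" "f contour_integrable_on linepath a4 a1"
    using assms(1) by (auto intro!: contour_integrable_continuous_linepath elim: continuous_on_subset)
  have "contour_integral (rectpath a1 a3) f =
    contour_integral (linepath a1 a2) f + (contour_integral (linepath a2 a3) f
    + (contour_integral (linepath a3 a4) f + contour_integral (linepath a4 a1) f))"
    using int by (simp add: rectpath_def Let_def flip: a2_def a4_def)
  moreover have "contour_integral (linepath a3 a4) f = - contour_integral (linepath a4 a3) f"
    "contour_integral (linepath a4 a1) f = - contour_integral (linepath a1 a4) f"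
    using contour_integral_reversepath[of "linepath a4 a3" f]
      contour_integral_reversepath[of "linepath a1 a4" f] by simp_all
  ultimately show ?thesis by simp
qed

text \<open>The denominator has simple zeros at the multiples of \<open>h\<close>, each with
  derivative \<open>2 * pi * \<i> / h\<close>, so the residue at a node is
  \<open>h / (2 * pi * \<i>)\<close> times the value of \<open>g\<close>. The half-integer width
  keeps the vertical sides midway between nodes.\<close>

lemma trapezoidal_residue_sum:
  fixes g :: "complex \<Rightarrow> complex" and m :: nat
  assumes h: "0 < h" and y: "0 < y" "y < d" and holo: "g holomorphic_on strip d"
  defines "R \<equiv> (real m + 1 / 2) * h"
  shows "contour_integral (rectpath (Complex (-R) (-y)) (Complex R y))
           (\<lambda>z. g z / (1 - exp (- (2 * pi * \<i> / h) * z)))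
         = h * (\<Sum>k\<in>{- int m..int m}. g (of_real (real_of_int k * h)))"
proof -
  define D where "D = (\<lambda>z. 1 - exp (- (2 * pi * \<i> / h) * z))"
  \<comment> \<open>The next zeros lie on the boundary of the open box \<open>S\<close>, so the
    nodes in \<open>P\<close> are the only zeros inside it.\<close>
  define L where "L = (real m + 1) * h"
  define S where "S = box (Complex (- L) (- d)) (Complex L d)"
  define P where "P = (\<lambda>k. complex_of_real (real_of_int k * h)) ` {- int m..int m}"
  have inS: "z \<in> S \<longleftrightarrow> - L < Re z \<and> Re z < L \<and> - d < Im z \<and> Im z < d" for z
    by (auto simp: S_def in_box_complex_iff)
  have R0: "0 < R" and RL: "R < L" using h by (auto simp: R_def L_def intro!: mult_pos_pos)
  have holoD: "D holomorphic_on A" for A unfolding D_def by (intro holomorphic_intros)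
  have D0: "z \<in> P" if "z \<in> S" "D z = 0" for z
  proof -
    have "exp (- (2 * pi * \<i> / h) * z) = 1" using that by (simp add: D_def)
    then obtain n :: int where "Re (- (2 * pi * \<i> / h) * z) = 0" "Im (- (2 * pi * \<i> / h) * z) = of_int (2 * n) * pi"
      by (auto simp: exp_eq_1)
    then have im: "Im z = 0" and "pi * (Re z + of_int n * h) = 0"
      using h by (auto simp: field_simps)
    then have re: "Re z = of_int (- n) * h" by simp
    have "- L < of_int (- n) * h" "of_int (- n) * h < L" using that(1) re by (auto simp: inS)
    then have "- (real m + 1) * h < of_int (- n) * h" "of_int (- n) * h < (real m + 1) * h"
      by (simp_all only: L_def mult_minus_left)
    then have "- (real m + 1) < of_int (- n)" "of_int (- n) < real m + 1"
      using mult_less_cancel_right_pos[OF h] by blast+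
    then have "- n \<in> {- int m..int m}" by auto
    moreover have "z = of_real (of_int (- n) * h)" using im re by (simp add: complex_eq_iff)
    ultimately show ?thesis unfolding P_def by blast
  qed
  have PS: "P \<subseteq> box (Complex (-R) (-y)) (Complex R y)"
  proof
    fix z assume "z \<in> P"
    then obtain k where k: "k \<in> {- int m..int m}" "z = of_real (real_of_int k * h)" by (auto simp: P_def)
    have "\<bar>real_of_int k\<bar> < real m + 1 / 2" using k(1) by auto
    then have "\<bar>real_of_int k * h\<bar> < R" using h by (simp add: abs_mult R_def)
    then show "z \<in> box (Complex (-R) (-y)) (Complex R y)" using y k(2) by (auto simp: in_box_complex_iff abs_less_iff)
  qed
  have boxS: "cbox (Complex (-R) (-y)) (Complex R y) \<subseteq> S"
    using RL y by (auto simp: inS in_cbox_complex_iff)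
  have Sstrip: "S \<subseteq> strip d" by (auto simp: inS strip_def)
  have "contour_integral (rectpath (Complex (-R) (-y)) (Complex R y)) (\<lambda>z. g z / D z)
    = 2 * pi * \<i> * (\<Sum>p\<in>P. winding_number (rectpath (Complex (-R) (-y)) (Complex R y)) p * residue (\<lambda>z. g z / D z) p)"
  proof (rule Residue_theorem)
    show "open S" "connected S" unfolding S_def by (auto intro: open_box convex_connected convex_box)
    show "finite P" by (simp add: P_def)
    show "(\<lambda>z. g z / D z) holomorphic_on S - P"
      using D0 Sstrip by (intro holomorphic_intros holomorphic_on_subset[OF holo] holoD) auto
    show "path_image (rectpath (Complex (- R) (- y)) (Complex R y)) \<subseteq> S - P"
      using path_image_rectpath_cbox_minus_box[of "Complex (-R) (-y)" "Complex R y"] R0 y PS boxS by auto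
    show "\<forall>z. z \<notin> S \<longrightarrow> winding_number (rectpath (Complex (- R) (- y)) (Complex R y)) z = 0"
    proof (intro allI impI)
      fix z assume "z \<notin> S"
      then show "winding_number (rectpath (Complex (- R) (- y)) (Complex R y)) z = 0"
        using boxS R0 y by (intro winding_number_rectpath_outside) auto
    qed
  qed auto
  also have "\<dots> = 2 * pi * \<i> * (\<Sum>p\<in>P. g p * h / (2 * pi * \<i>))"
  proof -
    have "winding_number (rectpath (Complex (-R) (-y)) (Complex R y)) p * residue (\<lambda>z. g z / D z) p
            = g p * h / (2 * pi * \<i>)" if p: "p \<in> P" for p
    proof -
      obtain k :: int where k: "k \<in> {- int m..int m}" "p = of_real (real_of_int k * h)" using p by (auto simp: P_def)
      have pS: "p \<in> S" using PS boxS p box_subset_cbox by blast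
      have Dp: "D p = 0"
        using h exp_integer_2pi[of "of_int (- k)"] by (simp add: D_def k(2) mult_ac)
      have wind: "winding_number (rectpath (Complex (-R) (-y)) (Complex R y)) p = 1"
        using PS p by (intro winding_number_rectpath) auto
      have derD: "(D has_field_derivative 2 * pi * \<i> / h) (at p)"
      proof -
        have "(D has_field_derivative (2 * pi * \<i> / h) * exp (- (2 * pi * \<i> / h) * p)) (at p)"
          unfolding D_def using h by (auto intro!: derivative_eq_intros)
        then show ?thesis using Dp h by (simp add: D_def)
      qed
      have "residue (\<lambda>z. g z / D z) p = g p / (2 * pi * \<i> / h)"
      proof (rule residue_simple')
        \<comment> \<open>The other nodes are removed so that \<open>p\<close> is the only
          singularity in an open set.\<close>
        define T where "T = S - (P - {p})"
        show "open T" unfolding T_def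
          by (intro open_Diff finite_imp_closed) (auto simp: S_def P_def open_box)
        show "p \<in> T" using pS by (simp add: T_def)
        show "(\<lambda>z. g z / D z) holomorphic_on T - {p}"
          using D0 Sstrip unfolding T_def
          by (intro holomorphic_intros holomorphic_on_subset[OF holo] holoD) auto
        have lim1: "((\<lambda>z. (D z - D p) / (z - p)) \<longlongrightarrow> 2 * pi * \<i> / h) (at p)"
          using derD by (simp add: has_field_derivative_iff)
        have lim2: "(g \<longlongrightarrow> g p) (at p)"
        proof -
          have "isCont g p"
            using holomorphic_on_imp_continuous_on[OF holomorphic_on_subset[OF holo Sstrip]] pS
            by (auto simp: continuous_on_eq_continuous_at S_def open_box)
          then show ?thesis by (simp add: isCont_def)
        qed
        have "((\<lambda>z. g z / ((D z - D p) / (z - p))) \<longlongrightarrow> g p / (2 * pi * \<i> / h)) (at p)"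
          using tendsto_divide[OF lim2 lim1] h by simp
        then show "((\<lambda>z. g z / D z * (z - p)) \<longlongrightarrow> g p / (2 * pi * \<i> / h)) (at p)"
          by (simp add: Dp)
      qed
      then show ?thesis using wind by simp
    qed
    then show ?thesis by simp
  qed
  also have "\<dots> = h * (\<Sum>p\<in>P. g p)"
    by (simp add: sum_distrib_left mult.commute)
  also have "(\<Sum>p\<in>P. g p) = (\<Sum>k\<in>{- int m..int m}. g (of_real (real_of_int k * h)))"
    unfolding P_def using h by (subst sum.reindex) (auto simp: inj_on_def)
  finally show ?thesis unfolding D_def .
qed

text \<open>The kernel is close to 0 on the top edge and close to 1 on the bottom edge. Subtracting
  \<open>g\<close> on the bottom and moving its integral up to the real axis by Cauchy's theorem
  leaves two edges with factor \<open>q / (1 - q)\<close>. The term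
  \<open>6 * y * \<epsilon>\<close> counts two sides of length \<open>2 * y\<close> for the kernel
  contour and two of length \<open>y\<close> for the Cauchy contour.\<close>

lemma trapezoidal_error_rectangle:
  fixes g :: "complex \<Rightarrow> complex" and m :: nat and B :: "real \<Rightarrow> real"
  assumes h: "0 < h" and y: "0 < y" "y < d" and holo: "g holomorphic_on strip d"
  defines "R \<equiv> (real m + 1 / 2) * h" and "q \<equiv> exp (- (2 * pi * y / h))"
  assumes B: "\<And>x. norm (g (Complex x y)) \<le> B x" "\<And>x. norm (g (Complex x (-y))) \<le> B x"
    and J: "(B has_integral J) {-R..R}"
    and \<epsilon>: "\<And>t. \<bar>t\<bar> \<le> y \<Longrightarrow> norm (g (Complex R t)) \<le> \<epsilon>" "\<And>t. \<bar>t\<bar> \<le> y \<Longrightarrow> norm (g (Complex (-R) t)) \<le> \<epsilon>"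
  shows "norm (integral {-R..R} (\<lambda>x. g (of_real x))
            - h * (\<Sum>k\<in>{- int m..int m}. g (of_real (real_of_int k * h))))
          \<le> 2 * J * (q / (1 - q)) + 6 * y * \<epsilon>"
proof -
  define E where "E = (\<lambda>z. exp (- (2 * pi * \<i> / h) * z))"
  define ker where "ker = (\<lambda>z. 1 / (1 - E z))"
  let ?gk = "\<lambda>z. g z / (1 - exp (- (2 * pi * \<i> / h) * z))"
  have gk: "?gk = (\<lambda>z. g z * ker z)" by (simp add: ker_def E_def)
  have R0: "0 < R" using h by (simp add: R_def)
  have q: "0 < q" "q < 1" using h y by (auto simp: q_def)
  have \<epsilon>0: "0 \<le> \<epsilon>" using \<epsilon>(1)[of 0] y norm_ge_zero order_trans by (metis abs_zero less_imp_le)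
  have normE: "norm (E z) = exp (2 * pi * Im z / h)" for z
    by (simp add: E_def)
  \<comment> \<open>Since \<open>R / h\<close> is a half-integer, \<open>E\<close> is a negative
    real on the vertical sides. Hence \<open>1 - E\<close> has modulus above 1 and the kernel is at
    most 1 there.\<close>
  have side: "E (Complex x t) = - of_real (exp (2 * pi * t / h))" if "x = R \<or> x = - R" for x t
  proof -
    have "x / h = real m + 1 / 2 \<or> x / h = - (real m + 1 / 2)"
      using that h by (auto simp: R_def)
    then have "2 * pi * (x / h) = 2 * pi * (real m + 1 / 2) \<or> 2 * pi * (x / h) = 2 * pi * (- (real m + 1 / 2))"
      by metis
    moreover have "2 * pi * (real m + 1 / 2) = 2 * pi * real m + pi" by (simp add: algebra_simps)
    ultimately have *: "2 * pi * x / h = 2 * pi * real m + pi \<or> 2 * pi * x / h = - (2 * pi * real m + pi)"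
      unfolding mult_minus_right by simp
    have c: "cos (2 * pi * real m) = 1" "sin (2 * pi * real m) = 0"
      using cos_2npi[of m] sin_2npi[of m] by (simp_all add: mult_ac)
    have "cos (2 * pi * x / h) = -1" "sin (2 * pi * x / h) = 0"
      using * by (elim disjE; simp only: cos_minus sin_minus cos_add sin_add c cos_pi sin_pi; simp)+
    then show ?thesis
      by (simp add: E_def complex_eq_iff Re_exp Im_exp)
  qed
  define bot where "bot = linepath (Complex (-R) (-y)) (Complex R (-y))"
  define top' where "top' = linepath (Complex (-R) y) (Complex R y)"
  define mid where "mid = linepath (Complex (-R) 0) (Complex R 0)"
  define rgt where "rgt = linepath (Complex R (-y)) (Complex R y)"
  define lft where "lft = linepath (Complex (-R) (-y)) (Complex (-R) y)"
  define rgt2 where "rgt2 = linepath (Complex R (-y)) (Complex R 0)"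
  define lft2 where "lft2 = linepath (Complex (-R) (-y)) (Complex (-R) 0)"
  have contg: "continuous_on A g" if "A \<subseteq> strip d" for A
    using holomorphic_on_imp_continuous_on[OF holo] that continuous_on_subset by blast
  have contE: "continuous_on A E" for A unfolding E_def by (intro continuous_intros)
  have contk: "continuous_on A (\<lambda>z. g z * ker z)" if "A \<subseteq> strip d" "\<And>z. z \<in> A \<Longrightarrow> E z \<noteq> 1" for A
    unfolding ker_def using that by (intro continuous_intros contg contE) auto
  have segH: "closed_segment (Complex (-R) t) (Complex R t) = {z. Im z = t \<and> \<bar>Re z\<bar> \<le> R}" for t
    using R0 by (auto simp: closed_segment_same_Im closed_segment_eq_real_ivl)
  have segV: "closed_segment (Complex x (-y)) (Complex x t) = {z. Re z = x \<and> Im z \<in> {-y..t}}" if "- y \<le> t" for x t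
    using that by (auto simp: closed_segment_same_Re closed_segment_eq_real_ivl)
  have Ene1_h: "E z \<noteq> 1" if "Im z = y \<or> Im z = - y" for z
  proof
    assume "E z = 1"
    then have "exp (2 * pi * Im z / h) = 1" using normE[of z] by simp
    then show False using that y h by auto
  qed
  have Ene1_v: "E z \<noteq> 1" if "Re z = R \<or> Re z = - R" for z
  proof
    assume "E z = 1"
    then have "1 = - complex_of_real (exp (2 * pi * Im z / h))" using side[OF that, of "Im z"] by simp
    then have "1 = - exp (2 * pi * Im z / h)"
      by (metis of_real_1 of_real_eq_iff of_real_minus)
    then show False using exp_gt_zero[of "2 * pi * Im z / h"] by linarith
  qed
  have kerv: "norm (ker z) \<le> 1" if "Re z = R \<or> Re z = - R" for z
  proof -
    have "1 - E z = of_real (1 + exp (2 * pi * Im z / h))" using side[OF that, of "Im z"] by simp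
    then have "norm (1 - E z) = 1 + exp (2 * pi * Im z / h)"
      by (metis norm_of_real abs_of_pos add_pos_pos exp_gt_zero zero_less_one)
    then show ?thesis by (simp add: ker_def norm_divide divide_le_eq add_pos_pos)
  qed
  have ker_top: "norm (ker z) \<le> q / (1 - q)" if "Im z = y" for z
  proof -
    have "norm (E z) = 1 / q" using normE[of z] that by (simp add: q_def exp_minus inverse_eq_divide)
    then have "1 / q - 1 \<le> norm (1 - E z)" using norm_triangle_ineq2[of "E z" 1] by (simp add: norm_minus_commute)
    moreover have "0 < 1 / q - 1" using q by simp
    ultimately have "norm (ker z) \<le> 1 / (1 / q - 1)"
      unfolding ker_def norm_divide norm_one by (intro divide_left_mono mult_pos_pos) auto
    also have "\<dots> = q / (1 - q)" using q by (simp add: field_simps)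
    finally show ?thesis .
  qed
  have ker_bot: "norm (ker z - 1) \<le> q / (1 - q)" if "Im z = - y" for z
  proof -
    have nE: "norm (E z) = q" using normE[of z] that by (simp add: q_def)
    then have le: "1 - q \<le> norm (1 - E z)" using norm_triangle_ineq2[of 1 "E z"] by simp
    have "ker z - 1 = E z / (1 - E z)" using Ene1_h[of z] that by (simp add: ker_def field_simps)
    then have "norm (ker z - 1) = q / norm (1 - E z)" by (simp add: norm_divide nE)
    also have "\<dots> \<le> q / (1 - q)" using le q by (intro divide_left_mono mult_pos_pos) auto
    finally show ?thesis .
  qed
  have JK: "((\<lambda>x. B x * (q / (1 - q))) has_integral J * (q / (1 - q))) {-R..R}"
    using J by (rule has_integral_mult_left)
  have C1: "contour_integral bot (\<lambda>z. g z * ker z) + contour_integral rgt (\<lambda>z. g z * ker z)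
      - contour_integral top' (\<lambda>z. g z * ker z) - contour_integral lft (\<lambda>z. g z * ker z)
      = h * (\<Sum>k\<in>{- int m..int m}. g (of_real (real_of_int k * h)))"
  proof -
    have "continuous_on (path_image (rectpath (Complex (-R) (-y)) (Complex R y))) (\<lambda>z. g z * ker z)"
      using R0 y Ene1_h Ene1_v by (intro contk) (auto simp: path_image_rectpath strip_def)
    from contour_integral_rectpath[OF this] trapezoidal_residue_sum[OF h y holo, of m, folded R_def]
    show ?thesis unfolding gk by (simp add: bot_def rgt_def top'_def lft_def)
  qed
  have C2: "contour_integral bot g + contour_integral rgt2 g - contour_integral mid g - contour_integral lft2 g = 0"
  proof -
    have sub: "path_image (rectpath (Complex (-R) (-y)) (Complex R 0)) \<subseteq> strip d"
      using R0 y by (auto simp: path_image_rectpath strip_def)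
    have "convex (strip d)"
    proof -
      have "strip d = {z. Im z < d} \<inter> {z. Im z > - d}" by (auto simp: strip_def)
      then show ?thesis by (simp add: convex_Int convex_halfspace_Im_lt convex_halfspace_Im_gt)
    qed
    then have "contour_integral (rectpath (Complex (-R) (-y)) (Complex R 0)) g = 0"
      using sub by (intro contour_integral_unique Cauchy_theorem_convex_simple[OF holo]) auto
    with contour_integral_rectpath[OF contg[OF sub]]
    show ?thesis by (simp add: bot_def rgt2_def mid_def lft2_def)
  qed
  have mid: "contour_integral mid g = integral {-R..R} (\<lambda>x. g (of_real x))"
  proof -
    have "continuous_on (closed_segment (Complex (-R) 0) (Complex R 0)) g"
      using y unfolding segH by (intro contg) (auto simp: strip_def)
    then have "(g has_contour_integral contour_integral mid g) mid"
      unfolding mid_def by (intro has_contour_integral_integral contour_integrable_continuous_linepath)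
    then have "((\<lambda>x. g (Complex x 0)) has_integral contour_integral mid g) {-R..R}"
      unfolding mid_def using R0 by (subst (asm) has_contour_integral_linepath_same_Im_iff) auto
    then show ?thesis by (simp add: integral_unique complex_of_real_def)
  qed
  have segbot: "closed_segment (Complex (-R) (-y)) (Complex R (-y)) \<subseteq> strip d"
    and segtop: "closed_segment (Complex (-R) y) (Complex R y) \<subseteq> strip d"
    using y unfolding segH by (auto simp: strip_def)
  have cgb: "continuous_on (closed_segment (Complex (-R) (-y)) (Complex R (-y))) g" using segbot by (rule contg)
  have cgkb: "continuous_on (closed_segment (Complex (-R) (-y)) (Complex R (-y))) (\<lambda>z. g z * ker z)"
    using segbot Ene1_h by (intro contk) (auto simp: segH)
  have bot_eq: "contour_integral bot (\<lambda>z. g z * ker z) - contour_integral bot g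
      = contour_integral bot (\<lambda>z. g z * (ker z - 1))"
  proof -
    have "contour_integral bot (\<lambda>z. g z * ker z) - contour_integral bot g
      = contour_integral bot (\<lambda>z. g z * ker z - g z)"
      unfolding bot_def by (intro contour_integral_diff[symmetric] contour_integrable_continuous_linepath cgb cgkb)
    then show ?thesis by (simp add: algebra_simps)
  qed
  have N1: "norm (contour_integral bot (\<lambda>z. g z * (ker z - 1))) \<le> J * (q / (1 - q))"
    unfolding bot_def
  proof (rule norm_contour_integral_same_Im_le[OF _ _ _ JK])
    show "continuous_on (closed_segment (Complex (-R) (-y)) (Complex R (-y))) (\<lambda>z. g z * (ker z - 1))"
      using continuous_on_diff[OF cgkb cgb] by (simp add: algebra_simps)
    show "norm (g (Complex x (-y)) * (ker (Complex x (-y)) - 1)) \<le> B x * (q / (1 - q))" for x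
      unfolding norm_mult using B(2)[of x] ker_bot[of "Complex x (-y)"] order_trans[OF norm_ge_zero B(2)[of x]]
      by (intro mult_mono) auto
  qed (use R0 in auto)
  have N2: "norm (contour_integral top' (\<lambda>z. g z * ker z)) \<le> J * (q / (1 - q))"
    unfolding top'_def
  proof (rule norm_contour_integral_same_Im_le[OF _ _ _ JK])
    show "continuous_on (closed_segment (Complex (-R) y) (Complex R y)) (\<lambda>z. g z * ker z)"
      using segtop Ene1_h by (intro contk) (auto simp: segH)
    show "norm (g (Complex x y) * ker (Complex x y)) \<le> B x * (q / (1 - q))" for x
      unfolding norm_mult using B(1)[of x] ker_top[of "Complex x y"] order_trans[OF norm_ge_zero B(1)[of x]]
      by (intro mult_mono) auto
  qed (use R0 in auto)
  have gv: "norm (g z) \<le> \<epsilon>" if "Re z = R \<or> Re z = - R" "\<bar>Im z\<bar> \<le> y" for z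
    using that \<epsilon>[of "Im z"] by (cases z) auto
  have gkv: "norm (g z * ker z) \<le> \<epsilon>" if "Re z = R \<or> Re z = - R" "\<bar>Im z\<bar> \<le> y" for z
  proof -
    have "norm (g z) * norm (ker z) \<le> \<epsilon> * 1"
      using gv[OF that] kerv[OF that(1)] \<epsilon>0 by (intro mult_mono) auto
    then show ?thesis by (simp add: norm_mult)
  qed
  have vert: "norm (contour_integral (linepath (Complex x (-y)) (Complex x t)) F) \<le> \<epsilon> * (t + y)"
    if "x = R \<or> x = - R" "- y \<le> t" "t \<le> y" and F: "continuous_on (closed_segment (Complex x (-y)) (Complex x t)) F"
      "\<And>z. Re z = R \<or> Re z = - R \<Longrightarrow> \<bar>Im z\<bar> \<le> y \<Longrightarrow> norm (F z) \<le> \<epsilon>" for x t F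
  proof -
    have "norm (contour_integral (linepath (Complex x (-y)) (Complex x t)) F) \<le> \<epsilon> * norm (Complex x t - Complex x (-y))"
    proof (rule contour_integral_bound_linepath)
      show "F contour_integrable_on linepath (Complex x (-y)) (Complex x t)"
        by (intro contour_integrable_continuous_linepath F)
      fix z assume "z \<in> closed_segment (Complex x (-y)) (Complex x t)"
      then show "norm (F z) \<le> \<epsilon>" using that segV[of t x] by (intro F(2)) auto
    qed (rule \<epsilon>0)
    also have "norm (Complex x t - Complex x (-y)) = t + y" using that by (simp add: cmod_def)
    finally show ?thesis .
  qed
  have contv: "continuous_on (closed_segment (Complex x (-y)) (Complex x t)) (\<lambda>z. g z * ker z)"
       "continuous_on (closed_segment (Complex x (-y)) (Complex x t)) g"
    if "x = R \<or> x = - R" "- y \<le> t" "t \<le> y" for x t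
    using that y Ene1_v segV[OF that(2), of x] by (auto intro!: contk contg simp: strip_def)
  have N3: "norm (contour_integral rgt (\<lambda>z. g z * ker z)) \<le> \<epsilon> * (y + y)"
    "norm (contour_integral lft (\<lambda>z. g z * ker z)) \<le> \<epsilon> * (y + y)"
    "norm (contour_integral rgt2 g) \<le> \<epsilon> * (0 + y)" "norm (contour_integral lft2 g) \<le> \<epsilon> * (0 + y)"
    unfolding rgt_def lft_def rgt2_def lft2_def
    using y gv gkv by (intro vert contv; simp)+
  define a1 a2 a3 a4 a5 a6 where "a1 = contour_integral bot (\<lambda>z. g z * (ker z - 1))"
    and "a2 = contour_integral top' (\<lambda>z. g z * ker z)"
    and "a3 = contour_integral rgt (\<lambda>z. g z * ker z)" and "a4 = contour_integral lft (\<lambda>z. g z * ker z)"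
    and "a5 = contour_integral rgt2 g" and "a6 = contour_integral lft2 g"
  have "contour_integral mid g = contour_integral bot g + a5 - a6" using C2 by (simp add: a5_def a6_def algebra_simps)
  then have "integral {-R..R} (\<lambda>x. g (of_real x)) - h * (\<Sum>k\<in>{- int m..int m}. g (of_real (real_of_int k * h)))
      = a5 - a6 - a1 - a3 + a2 + a4"
    unfolding mid[symmetric] C1[symmetric]
    using bot_eq by (simp add: a1_def a2_def a3_def a4_def algebra_simps)
  also have "norm \<dots> \<le> norm a5 + norm a6 + norm a1 + norm a3 + norm a2 + norm a4"
    by (intro norm_add_rule_thm order_trans[OF norm_triangle_ineq4] order_trans[OF norm_triangle_ineq] add_mono order_refl)
  also have "\<dots> \<le> \<epsilon> * (0 + y) + \<epsilon> * (0 + y) + J * (q / (1 - q)) + \<epsilon> * (y + y) + J * (q / (1 - q)) + \<epsilon> * (y + y)"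
    unfolding a1_def a2_def a3_def a4_def a5_def a6_def by (intro add_mono N1 N2 N3)
  also have "\<dots> = 2 * J * (q / (1 - q)) + 6 * y * \<epsilon>" by (simp add: algebra_simps)
  finally show ?thesis .
qed

section \<open>Improper integrals\<close>

lemma power2_powr_half: "0 \<le> x \<Longrightarrow> (x\<^sup>2) powr (e / 2) = x powr e" for x :: real
  by (cases "x = 0") (simp_all add: powr_def ln_realpow)

lemma integral_symmetric_interval_tendsto:
  fixes F :: "real \<Rightarrow> 'a :: banach" and r :: "nat \<Rightarrow> real"
  assumes "F integrable_on UNIV" and r: "filterlim r at_top sequentially"
  shows "(\<lambda>m. integral {- r m..r m} F) \<longlonglongrightarrow> integral UNIV F"
proof (rule LIMSEQ_I)
  fix e :: real assume "0 < e"
  have "(F has_integral integral UNIV F) UNIV" using assms(1) by (rule integrable_integral)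
  then obtain B where B: "\<And>a b. ball 0 B \<subseteq> cbox a b \<Longrightarrow> norm (integral (cbox a b) F - integral UNIV F) < e"
    using \<open>0 < e\<close> unfolding has_integral_alt' by (simp only: UNIV_I if_True) blast
  have "eventually (\<lambda>m. B \<le> r m) sequentially" using r by (simp add: filterlim_at_top)
  then obtain m0 where m0: "\<And>m. m0 \<le> m \<Longrightarrow> B \<le> r m" by (auto simp: eventually_sequentially)
  have "norm (integral {- r m..r m} F - integral UNIV F) < e" if "m0 \<le> m" for m
  proof -
    have "ball 0 B \<subseteq> cbox (- r m) (r m)" using m0[OF that] by (auto simp: dist_real_def)
    then show ?thesis using B by simp
  qed
  then show "\<exists>no. \<forall>m\<ge>no. norm (integral {- r m..r m} F - integral UNIV F) < e" by blast
qed

text \<open>The comparison function \<open>\<bar>t\<bar> powr (- (\<mu> + 1))\<close> is integrable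
  only away from 0, so continuity handles the middle interval.\<close>

lemma integrable_on_UNIV_polynomial_decay:
  fixes F :: "real \<Rightarrow> complex"
  assumes cont: "continuous_on UNIV F" and "0 \<le> K" and \<mu>: "0 < \<mu>"
    and bound: "\<And>t. norm (F t) \<le> K * (1 + t\<^sup>2) powr (- (\<mu> + 1) / 2)"
  shows "F integrable_on UNIV"
proof -
  have dec: "norm (F t) \<le> K * \<bar>t\<bar> powr (- (\<mu> + 1))" if "t \<noteq> 0" for t
  proof -
    have "norm (F t) \<le> K * (1 + t\<^sup>2) powr (- (\<mu> + 1) / 2)" by (rule bound)
    also have "\<dots> \<le> K * (\<bar>t\<bar>\<^sup>2) powr (- (\<mu> + 1) / 2)"
      using that \<mu> \<open>0 \<le> K\<close> by (intro mult_left_mono powr_mono2') auto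
    also have "(\<bar>t\<bar>\<^sup>2) powr (- (\<mu> + 1) / 2) = \<bar>t\<bar> powr (- (\<mu> + 1))"
      by (rule power2_powr_half) simp
    finally show ?thesis .
  qed
  define G where "G = (\<lambda>t. K * \<bar>t\<bar> powr (- (\<mu> + 1)))"
  have "(\<lambda>t. K * t powr (- (\<mu> + 1))) integrable_on {1..}"
    using has_integral_powr_to_inf[of "- (\<mu> + 1)" 1] \<mu>
    by (intro integrable_on_mult_right) (auto simp: integrable_on_def)
  then have G1: "G integrable_on {1..}"
    by (rule integrable_eq) (simp add: G_def)
  then have "G absolutely_integrable_on {1..}"
    using \<open>0 \<le> K\<close> by (intro nonnegative_absolutely_integrable_1) (auto simp: G_def)
  then have G2: "G integrable_on {..-1}"
    using has_absolute_integral_reflect_real[of "{1..}" "{..-1}" G "integral {1..} G"]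
    by (auto simp: G_def absolutely_integrable_on_def)
  have part: "F integrable_on A" if "G integrable_on A" "A \<in> sets lebesgue" "0 \<notin> A" for A
  proof (rule measurable_bounded_by_integrable_imp_integrable[OF _ that(1)])
    show "F \<in> borel_measurable (lebesgue_on A)"
      by (intro continuous_imp_measurable_on_sets_lebesgue continuous_on_subset[OF cont] that) auto
    show "norm (F t) \<le> G t" if "t \<in> A" for t
      using dec[of t] that \<open>0 \<notin> A\<close> by (auto simp: G_def)
  qed (rule that)
  have left: "F integrable_on {..-1}" and right: "F integrable_on {1..}"
    using G1 G2 by (auto intro!: part)
  have mid: "F integrable_on {-1..1}"
    by (intro integrable_continuous_real continuous_on_subset[OF cont]) auto
  have "{..-1} \<inter> {-1..1} = {-1 :: real}" "({..-1} \<union> {-1..1}) \<inter> {1..} = {1 :: real}" by auto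
  then have "F integrable_on (({..-1} \<union> {-1..1}) \<union> {1..})"
    using integrable_Un[OF _ integrable_Un[OF _ left mid] right] by simp
  moreover have "({..-1} \<union> {-1..1}) \<union> {1..} = (UNIV :: real set)" by auto
  ultimately show ?thesis by simp
qed

section \<open>The transformed integrand\<close>

lemma sinh_of_real_complex: "sinh (of_real x :: complex) = of_real (sinh x)"
  by (simp add: sinh_field_def exp_minus exp_of_real)

lemma DERIV_psi:
  "(psi has_field_derivative of_real (pi / 2) * cosh z * cosh (of_real (pi / 2) * sinh z)) (at z)"
  unfolding psi_def[abs_def] by (auto intro!: derivative_eq_intros)

lemma deriv_psi: "deriv psi z = of_real (pi / 2) * cosh z * cosh (of_real (pi / 2) * sinh z)"
  using DERIV_psi by (rule DERIV_imp_deriv)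

text \<open>This explains the form of the decay hypotheses: they bound \<open>f\<close> by the power
  \<open>- (\<gamma> + 1)\<close> of the modulus of this cosh, and the derivative of
  \<open>psi\<close> restores one factor, which leaves the power \<open>- \<gamma>\<close>.\<close>

lemma one_plus_psi_sq: "1 + (psi z)\<^sup>2 = (cosh (of_real (pi / 2) * sinh z))\<^sup>2"
  by (simp add: psi_def cosh_square_eq)

lemma psi_of_real: "psi (of_real x) = of_real (sinh (pi / 2 * sinh x))"
  unfolding psi_def sinh_of_real_complex by (simp only: of_real_mult[symmetric] sinh_of_real_complex)

lemma cos_half_pi_sin_pos:
  fixes y :: real
  assumes "0 \<le> y" "y < pi / 2"
  shows "0 < cos (pi / 2 * sin y)"
proof (rule cos_gt_zero_pi)
  have "sin y < 1" using assms sin_monotone_2pi[of y "pi / 2"] by simp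
  then have "pi / 2 * sin y < pi / 2 * 1" by (intro mult_strict_left_mono) auto
  then show "pi / 2 * sin y < pi / 2" by simp
  have "0 \<le> sin y" using assms by (intro sin_ge_zero) auto
  then show "- (pi / 2) < pi / 2 * sin y"
    using mult_nonneg_nonneg[of "pi / 2" "sin y"] pi_gt_zero by linarith
qed

lemma cos_half_pi_sin_antimono:
  fixes t y :: real
  assumes "\<bar>t\<bar> \<le> y" "y < pi / 2"
  shows "cos (pi / 2 * sin y) \<le> cos (pi / 2 * sin t)"
proof -
  have "0 \<le> sin \<bar>t\<bar>" using assms by (intro sin_ge_zero) auto
  moreover have "sin \<bar>t\<bar> \<le> sin y" using assms by (intro sin_monotone_2pi_le) auto
  moreover have "pi / 2 * sin y \<le> pi"
    using mult_left_mono[OF sin_le_one[of y], of "pi / 2"] pi_gt_zero by linarith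
  ultimately have "cos (pi / 2 * sin y) \<le> cos (pi / 2 * sin \<bar>t\<bar>)"
    by (intro cos_monotone_0_pi_le) auto
  then show ?thesis by (cases "0 \<le> t") auto
qed

text \<open>Both cosine factors decrease in \<open>\<bar>Im z\<bar>\<close>, so their values at
  \<open>Y\<close> serve a whole vertical segment; \<open>Y = 0\<close> covers the real nodes. The
  factor \<open>2 powr \<gamma>\<close> comes from \<open>cosh a \<ge> exp a / 2\<close>, and
  \<open>\<gamma> * cos Y\<close> from the normalization of the weight.\<close>

lemma norm_transformed_integrand_le:
  assumes Y: "\<bar>Im z\<bar> \<le> Y" "Y < pi / 2" and K: "0 \<le> K" and \<gamma>: "0 < \<gamma>"
    and bound: "norm (f (psi z)) \<le> K * norm (1 + (psi z)\<^sup>2) powr (- (\<gamma> + 1) / 2)"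
  shows "norm (f (psi z) * deriv psi z)
    \<le> K * 2 powr \<gamma> / (\<gamma> * cos Y * cos (pi / 2 * sin Y) powr \<gamma>) * de_weight (\<gamma> * pi / 2 * cos Y) \<bar>Re z\<bar>"
proof -
  define x y where "x = Re z" and "y = Im z"
  define W where "W = norm (cosh (of_real (pi / 2) * sinh z))"
  define a where "a = pi / 2 * (sinh \<bar>x\<bar> * cos Y)"
  define c where "c = cos (pi / 2 * sin Y)"
  have Y0: "0 \<le> Y" using Y by simp
  have cosY: "0 < cos Y" using Y0 Y by (intro cos_gt_zero_pi) auto
  have c0: "0 < c" unfolding c_def using Y0 Y by (intro cos_half_pi_sin_pos) auto
  have cosy: "cos Y \<le> cos y"
  proof -
    have "cos Y \<le> cos \<bar>y\<bar>" using Y by (intro cos_monotone_0_pi_le) (auto simp: y_def)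
    then show ?thesis by (cases "0 \<le> y") auto
  qed
  have cy: "c \<le> cos (pi / 2 * sin y)" unfolding c_def y_def using Y by (rule cos_half_pi_sin_antimono)
  have cosh_ge: "exp a / 2 \<le> cosh (pi / 2 * (sinh x * cos y))"
  proof -
    have "exp a / 2 \<le> cosh a" by (simp add: cosh_field_def)
    also have "\<dots> \<le> cosh (pi / 2 * (sinh \<bar>x\<bar> * cos y))"
      unfolding a_def using cosy cosY by (subst cosh_real_nonneg_le_iff) (auto intro!: mult_nonneg_nonneg mult_left_mono)
    also have "\<dots> = cosh (pi / 2 * (sinh x * cos y))" by (cases "0 \<le> x") auto
    finally show ?thesis .
  qed
  have V: "exp a / 2 * c \<le> W"
  proof -
    have "exp a / 2 * c \<le> cosh (pi / 2 * (sinh x * cos y)) * cos (pi / 2 * sin y)"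
      using cosh_ge cy c0 by (intro mult_mono) auto
    also have "\<dots> \<le> W" unfolding W_def x_def y_def using Y by (intro norm_cosh_half_pi_sinh_ge) auto
    finally show ?thesis .
  qed
  have V0: "0 < exp a / 2 * c" using c0 by simp
  then have W0: "0 < W" using V by linarith
  have "norm (f (psi z)) \<le> K * (W\<^sup>2) powr (- (\<gamma> + 1) / 2)"
    using bound unfolding one_plus_psi_sq W_def by (simp add: norm_power)
  also have "(W\<^sup>2) powr (- (\<gamma> + 1) / 2) = W powr (- (\<gamma> + 1))"
    using W0 by (intro power2_powr_half) simp
  finally have f: "norm (f (psi z)) \<le> K * W powr (- (\<gamma> + 1))" .
  have "norm (f (psi z) * deriv psi z) = norm (f (psi z)) * (pi / 2 * norm (cosh z) * W)"
    by (simp add: deriv_psi W_def norm_mult)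
  also have "\<dots> \<le> K * W powr (- (\<gamma> + 1)) * (pi / 2 * cosh x * W)"
    using f W0 K norm_cosh_le[of z] by (intro mult_mono) (auto simp: x_def)
  also have "\<dots> = K * (pi / 2) * cosh x * (W powr (- (\<gamma> + 1)) * W)" by simp
  also have "W powr (- (\<gamma> + 1)) * W = W powr (- \<gamma>)"
    using W0 by (simp add: powr_mult_base' powr_add powr_diff powr_minus field_simps)
  also have "K * (pi / 2) * cosh x * W powr (- \<gamma>) \<le> K * (pi / 2) * cosh x * (exp a / 2 * c) powr (- \<gamma>)"
    using V V0 K \<gamma> by (intro mult_left_mono powr_mono2') auto
  also have "(exp a / 2 * c) powr (- \<gamma>) = exp (- (\<gamma> * a)) * 2 powr \<gamma> / c powr \<gamma>"
    using c0 by (simp add: powr_mult powr_divide powr_minus exp_powr_real exp_minus field_simps)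
  also have "K * (pi / 2) * cosh x * (exp (- (\<gamma> * a)) * 2 powr \<gamma> / c powr \<gamma>)
      = K * 2 powr \<gamma> / (\<gamma> * cos Y * c powr \<gamma>) * de_weight (\<gamma> * pi / 2 * cos Y) \<bar>x\<bar>"
    using \<gamma> cosY by (cases "0 \<le> x") (simp_all add: de_weight_def a_def mult_ac)
  finally show ?thesis by (simp add: c_def x_def)
qed

lemma holomorphic_transformed_integrand:
  assumes "f analytic_on (psi ` strip d)"
  shows "(\<lambda>z. f (psi z) * deriv psi z) holomorphic_on strip d"
proof -
  have hp: "psi holomorphic_on UNIV"
    using DERIV_psi by (auto simp: holomorphic_on_def field_differentiable_def intro: has_field_derivative_at_within)
  have "psi analytic_on strip d"
    using hp analytic_on_subset[of psi UNIV] by (simp add: analytic_on_open)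
  then have "(f \<circ> psi) analytic_on strip d" using assms by (rule analytic_on_compose)
  then have "(f \<circ> psi) holomorphic_on strip d" by (rule analytic_imp_holomorphic)
  moreover have "deriv psi holomorphic_on strip d"
    using holomorphic_deriv[OF hp] holomorphic_on_subset by blast
  ultimately show ?thesis unfolding o_def by (rule holomorphic_on_mult)
qed

lemma integral_transformed_integrand:
  assumes cont: "continuous_on UNIV (\<lambda>t::real. f (complex_of_real t))" and "0 \<le> R"
  shows "integral {-R..R} (\<lambda>x. f (psi (of_real x)) * deriv psi (of_real x))
           = integral {- sinh (pi / 2 * sinh R)..sinh (pi / 2 * sinh R)} (\<lambda>t. f (of_real t))"
proof -
  define p where "p = (\<lambda>x::real. sinh (pi / 2 * sinh x))"
  define p' where "p' = (\<lambda>x::real. pi / 2 * cosh x * cosh (pi / 2 * sinh x))"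
  have dp: "(p has_real_derivative p' x) (at x within A)" for x A
    unfolding p_def p'_def by (auto intro!: derivative_eq_intros)
  have mono: "p x \<le> p x'" if "x \<le> x'" for x x' using that by (simp add: p_def)
  have "((\<lambda>x. p' x *\<^sub>R f (of_real (p x))) has_integral integral {p (-R)..p R} (\<lambda>t. f (of_real t))) {-R..R}"
    using assms(2) dp mono
    by (intro has_integral_substitution[where c = "p (-R)" and d = "p R"] continuous_on_subset[OF cont]) auto
  moreover have "p' x *\<^sub>R f (of_real (p x)) = f (psi (of_real x)) * deriv psi (of_real x)" for x
  proof -
    have "(psi has_field_derivative of_real (p' x)) (at (of_real x))"
    proof -
      have cosh: "cosh (of_real u :: complex) = of_real (cosh u)" for u
        by (simp add: cosh_field_def exp_minus exp_of_real)
      show ?thesis using DERIV_psi[of "of_real x"]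
        unfolding p'_def sinh_of_real_complex by (simp only: of_real_mult[symmetric] cosh)
    qed
    then show ?thesis
      by (simp add: DERIV_imp_deriv psi_of_real p_def scaleR_conv_of_real mult.commute)
  qed
  ultimately show ?thesis by (simp add: integral_unique p_def)
qed

text \<open>\<open>psi\<close> maps the real axis onto itself, with an explicit inverse. This
  transfers analyticity and decay of \<open>f\<close> on the image of the strip to every real
  argument.\<close>

lemma of_real_in_psi_strip:
  fixes t :: real
  assumes "0 < d"
  obtains x where "of_real t = psi (of_real x)" "of_real x \<in> strip d"
proof
  define x where "x = arsinh (2 / pi * arsinh t)"
  show "of_real t = psi (of_real x)" by (simp add: psi_of_real x_def)
  show "of_real x \<in> strip d" using assms by (simp add: strip_def)
qed

section \<open>Discretization and truncation\<close>

lemma has_integral_de_weight: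
  assumes "0 \<le> R"
  shows "(de_weight a has_integral 1 - exp (- (a * sinh R))) {0..R}"
proof -
  have "(de_weight a has_integral (- exp (- (a * sinh R)) - - exp (- (a * sinh 0)))) {0..R}"
    using assms DERIV_exp_neg_sinh[of a]
    by (intro fundamental_theorem_of_calculus) (auto simp flip: has_real_derivative_iff_has_vector_derivative)
  then show ?thesis by simp
qed

lemma has_integral_two_sided_de_weight:
  assumes "0 \<le> R"
  shows "((\<lambda>x. if x < 0 then u * de_weight a (- x) else v * de_weight b x) has_integral
           u * (1 - exp (- (a * sinh R))) + v * (1 - exp (- (b * sinh R)))) {-R..R}"
proof (rule has_integral_combine[of "-R" 0 R])
  have "((\<lambda>x. de_weight a (- x)) has_integral 1 - exp (- (a * sinh R))) {-R..-0}"
    by (subst has_integral_reflect_real) (rule has_integral_de_weight[OF assms])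
  then have "((\<lambda>x. u * de_weight a (- x)) has_integral u * (1 - exp (- (a * sinh R)))) {-R..0}"
    by (intro has_integral_mult_right) simp
  \<comment> \<open>At 0 the integrand takes the other branch; a single point does not
    matter.\<close>
  then show "((\<lambda>x. if x < 0 then u * de_weight a (- x) else v * de_weight b x) has_integral
      u * (1 - exp (- (a * sinh R)))) {-R..0}"
    by (rule has_integral_spike_finite[of "{0}", rotated -1]) auto
  have "((\<lambda>x. v * de_weight b x) has_integral v * (1 - exp (- (b * sinh R)))) {0..R}"
    by (intro has_integral_mult_right has_integral_de_weight assms)
  then show "((\<lambda>x. if x < 0 then u * de_weight a (- x) else v * de_weight b x) has_integral
      v * (1 - exp (- (b * sinh R)))) {0..R}"
    by (rule has_integral_eq[rotated]) auto
qed (use assms in auto)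

lemma de_weight_tendsto_0:
  assumes "0 < a"
  shows "(de_weight a \<longlongrightarrow> 0) at_top"
  unfolding de_weight_def[abs_def] cosh_field_def sinh_field_def using assms by real_asymp

lemma sum_int_greaterThanAtMost_shift:
  fixes F :: "int \<Rightarrow> 'a :: comm_monoid_add"
  shows "(\<Sum>k\<in>{N<..N + int l}. F k) = (\<Sum>j<l. F (N + int (Suc j)))"
proof (induction l)
  case (Suc l)
  have "{N<..N + int (Suc l)} = insert (N + int (Suc l)) {N<..N + int l}" by auto
  then show ?case using Suc by (simp add: add.commute)
qed simp

lemma norm_sum_int_tail_le:
  fixes F :: "int \<Rightarrow> complex"
  assumes h: "0 < h" and c: "0 \<le> c"
    and F: "\<And>k. N < k \<Longrightarrow> norm (F k) \<le> c * de_weight a (real_of_int k * h)"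
    and tail: "\<And>l. h * (\<Sum>j<l. de_weight a (real_of_int N * h + real (Suc j) * h)) \<le> \<tau>"
  shows "h * norm (\<Sum>k\<in>{N<..N + int l}. F k) \<le> c * \<tau>"
proof -
  have "norm (\<Sum>k\<in>{N<..N + int l}. F k) \<le> (\<Sum>k\<in>{N<..N + int l}. c * de_weight a (real_of_int k * h))"
    by (intro sum_norm_le F) auto
  also have "\<dots> = c * (\<Sum>j<l. de_weight a (real_of_int N * h + real (Suc j) * h))"
    by (subst sum_int_greaterThanAtMost_shift) (simp add: sum_distrib_left algebra_simps)
  finally have "h * norm (\<Sum>k\<in>{N<..N + int l}. F k)
      \<le> h * (c * (\<Sum>j<l. de_weight a (real_of_int N * h + real (Suc j) * h)))"
    using h by (intro mult_left_mono) auto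
  also have "\<dots> = c * (h * (\<Sum>j<l. de_weight a (real_of_int N * h + real (Suc j) * h)))" by simp
  also have "\<dots> \<le> c * \<tau>" using c by (intro mult_left_mono tail)
  finally show ?thesis .
qed

text \<open>The height \<open>y\<close> stays below \<open>d\<close> because nothing is known about
  \<open>f\<close> on the boundary. The window from \<open>-M\<close> to \<open>N\<close> is
  compared with symmetric windows from \<open>-m\<close> to \<open>m\<close>, to which the rectangle
  estimate applies, and \<open>m\<close> tends to infinity. The tail bounds are uniform in the
  number of terms, so they survive the limit.\<close>

lemma de_quadrature_error_le:
  fixes f :: "complex \<Rightarrow> complex" and d K \<alpha> \<beta> h y \<tau> \<tau>' :: real and M N :: int
  assumes d: "0 < d" "d < pi / 2" and f_an: "f analytic_on (psi ` strip d)"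
    and K: "K > 0" and \<alpha>: "\<alpha> > 0" and \<beta>: "\<beta> > 0"
    and bound_minus: "\<And>z. z \<in> psi ` strip_minus d \<Longrightarrow> norm (f z) \<le> K * norm (1 + z^2) powr (-(\<alpha> + 1)/2)"
    and bound_plus: "\<And>z. z \<in> psi ` strip_plus d \<Longrightarrow> norm (f z) \<le> K * norm (1 + z^2) powr (-(\<beta> + 1)/2)"
    and h: "0 < h" and y: "0 < y" "y < d" and M: "0 \<le> M" and N: "0 \<le> N"
    and \<tau>: "\<And>l. h * (\<Sum>j<l. de_weight (\<alpha> * pi / 2) (real_of_int M * h + real (Suc j) * h)) \<le> \<tau>"
    and \<tau>': "\<And>l. h * (\<Sum>j<l. de_weight (\<beta> * pi / 2) (real_of_int N * h + real (Suc j) * h)) \<le> \<tau>'"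
  defines "W \<equiv> \<lambda>\<gamma>. K * 2 powr \<gamma> / (\<gamma> * cos y * cos (pi / 2 * sin y) powr \<gamma>)"
    and "q \<equiv> exp (- (2 * pi * y / h))"
  shows "norm (integral UNIV (\<lambda>t::real. f (of_real t)) - of_real h *
      (\<Sum>k\<in>{-M..N}. f (psi (of_real (real_of_int k * h))) * deriv psi (of_real (real_of_int k * h))))
    \<le> 2 * (W \<alpha> + W \<beta>) * (q / (1 - q)) + K * 2 powr \<alpha> / \<alpha> * \<tau> + K * 2 powr \<beta> / \<beta> * \<tau>'"
proof -
  define g where "g = (\<lambda>z. f (psi z) * deriv psi z)"
  define I where "I = integral UNIV (\<lambda>t::real. f (of_real t))"
  define S where "S = (\<lambda>A. \<Sum>k\<in>A. g (of_real (real_of_int k * h)))"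
  define R where "R = (\<lambda>m. (real m + 1 / 2) * h)"
  define E where "E = norm (I - of_real h * S {-M..N})"
  define T where "T = K * 2 powr \<alpha> / \<alpha> * \<tau> + K * 2 powr \<beta> / \<beta> * \<tau>'"
  have q: "0 < q" "q < 1" using h y by (auto simp: q_def)
  have cosy: "0 < cos y" using y d by (intro cos_gt_zero_pi) auto
  have cy: "0 < cos (pi / 2 * sin y)" using y d by (intro cos_half_pi_sin_pos) auto
  have W: "0 \<le> W \<gamma>" if "0 < \<gamma>" for \<gamma> using that K cosy unfolding W_def by simp
  have gm: "norm (g z) \<le> K * 2 powr \<alpha> / (\<alpha> * cos Y * cos (pi / 2 * sin Y) powr \<alpha>) * de_weight (\<alpha> * pi / 2 * cos Y) \<bar>Re z\<bar>"
    if "\<bar>Im z\<bar> \<le> Y" "Y < d" "Re z < 0" for z Y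
    unfolding g_def using that d K \<alpha> by (intro norm_transformed_integrand_le bound_minus) (auto simp: strip_minus_def strip_def)
  have gp: "norm (g z) \<le> K * 2 powr \<beta> / (\<beta> * cos Y * cos (pi / 2 * sin Y) powr \<beta>) * de_weight (\<beta> * pi / 2 * cos Y) \<bar>Re z\<bar>"
    if "\<bar>Im z\<bar> \<le> Y" "Y < d" "0 \<le> Re z" for z Y
    unfolding g_def using that d K \<beta> by (intro norm_transformed_integrand_le bound_plus) (auto simp: strip_plus_def strip_def)
  have cont: "continuous_on UNIV (\<lambda>t::real. f (of_real t))"
  proof (rule continuous_at_imp_continuous_on, rule ballI)
    fix t :: real
    obtain x where "of_real t = psi (of_real x)" "complex_of_real x \<in> strip d" using of_real_in_psi_strip[OF d(1)] by metis
    then have "isCont f (of_real t)"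
      using analytic_on_imp_differentiable_at[OF f_an] by (intro field_differentiable_imp_continuous_at) auto
    then show "isCont (\<lambda>t::real. f (of_real t)) t"
      by (intro isCont_o2[where f = complex_of_real and g = f]) (auto intro: continuous_intros)
  qed
  have integrable: "(\<lambda>t::real. f (of_real t)) integrable_on UNIV"
  proof (rule integrable_on_UNIV_polynomial_decay[OF cont])
    show "0 < min \<alpha> \<beta>" "0 \<le> K" using \<alpha> \<beta> K by auto
    fix t :: real
    obtain x where x: "of_real t = psi (of_real x)" "complex_of_real x \<in> strip d"
      using of_real_in_psi_strip[OF d(1)] by metis
    have n1: "norm (1 + (complex_of_real t)\<^sup>2) = 1 + t\<^sup>2"
      by (metis abs_of_nonneg add_nonneg_nonneg norm_of_real of_real_1 of_real_add of_real_power zero_le_one zero_le_power2)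
    have "norm (f (of_real t)) \<le> K * (1 + t\<^sup>2) powr (- (\<alpha> + 1) / 2) \<or> norm (f (of_real t)) \<le> K * (1 + t\<^sup>2) powr (- (\<beta> + 1) / 2)"
    proof (cases "x < 0")
      case True
      then have "of_real t \<in> psi ` strip_minus d" using x by (auto simp: strip_minus_def)
      then show ?thesis using bound_minus n1 by metis
    next
      case False
      then have "of_real t \<in> psi ` strip_plus d" using x by (auto simp: strip_plus_def)
      then show ?thesis using bound_plus n1 by metis
    qed
    \<comment> \<open>The base is at least 1, so the weaker of the two decay rates serves both
      half-lines.\<close>
    moreover have "K * (1 + t\<^sup>2) powr (- (\<gamma> + 1) / 2) \<le> K * (1 + t\<^sup>2) powr (- (min \<alpha> \<beta> + 1) / 2)"
      if "min \<alpha> \<beta> \<le> \<gamma>" for \<gamma>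
      using that K by (intro mult_left_mono powr_mono) auto
    ultimately show "norm (f (of_real t)) \<le> K * (1 + t\<^sup>2) powr (- (min \<alpha> \<beta> + 1) / 2)"
      by (meson min.cobounded1 min.cobounded2 order_trans)
  qed
  have Rtop: "filterlim R at_top sequentially" unfolding R_def using h by real_asymp
  have Rpos: "0 < R m" for m using h by (simp add: R_def)
  define I' where "I' = (\<lambda>m. integral {- R m..R m} (\<lambda>x. g (of_real x)))"
  have I_lim: "I' \<longlonglongrightarrow> I"
  proof -
    have "filterlim (\<lambda>m. sinh (pi / 2 * sinh (R m))) at_top sequentially"
      by (intro filterlim_compose[OF sinh_real_at_top] filterlim_tendsto_pos_mult_at_top[OF tendsto_const] Rtop) auto
    from integral_symmetric_interval_tendsto[OF integrable this]
    show ?thesis unfolding I'_def I_def g_def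
      using Rpos by (subst integral_transformed_integrand[OF cont]) (auto simp: less_imp_le)
  qed
  define \<epsilon> where "\<epsilon> = (\<lambda>m. W \<alpha> * de_weight (\<alpha> * pi / 2 * cos y) (R m) + W \<beta> * de_weight (\<beta> * pi / 2 * cos y) (R m))"
  have eps_lim: "\<epsilon> \<longlonglongrightarrow> 0"
  proof -
    have "\<epsilon> \<longlonglongrightarrow> W \<alpha> * 0 + W \<beta> * 0" unfolding \<epsilon>_def
      using \<alpha> \<beta> cosy by (intro tendsto_intros filterlim_compose[OF de_weight_tendsto_0] Rtop) auto
    then show ?thesis by simp
  qed
  have disc: "norm (I' m - of_real h * S {- int m..int m}) \<le> 2 * (W \<alpha> + W \<beta>) * (q / (1 - q)) + 6 * y * \<epsilon> m" for m
  proof -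
    define B where "B = (\<lambda>x. if x < 0 then W \<alpha> * de_weight (\<alpha> * pi / 2 * cos y) (- x) else W \<beta> * de_weight (\<beta> * pi / 2 * cos y) x)"
    define J where "J = W \<alpha> * (1 - exp (- ((\<alpha> * pi / 2 * cos y) * sinh (R m)))) + W \<beta> * (1 - exp (- ((\<beta> * pi / 2 * cos y) * sinh (R m))))"
    have dw: "0 \<le> de_weight (\<gamma> * pi / 2 * cos y) x" if "0 < \<gamma>" for \<gamma> x
      using that cosy by (intro de_weight_nonneg) auto
    \<comment> \<open>Each weight has total mass at most 1 on its half-line, whatever its
      parameter.\<close>
    have "J \<le> W \<alpha> * 1 + W \<beta> * 1"
      unfolding J_def using W[OF \<alpha>] W[OF \<beta>] by (intro add_mono mult_left_mono) auto
    have "norm (I' m - of_real h * S {- int m..int m}) \<le> 2 * J * (q / (1 - q)) + 6 * y * \<epsilon> m"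
      unfolding I'_def S_def R_def q_def
    proof (rule trapezoidal_error_rectangle[OF h y])
      show "g holomorphic_on strip d" unfolding g_def by (rule holomorphic_transformed_integrand[OF f_an])
      have gB: "norm (g (Complex x t)) \<le> B x" if "\<bar>t\<bar> = y" for x t
        using gm[of "Complex x t" y] gp[of "Complex x t" y] that y by (auto simp: B_def W_def)
      show "norm (g (Complex x y)) \<le> B x" "norm (g (Complex x (- y))) \<le> B x" for x
        using gB[of y x] gB[of "- y" x] y by auto
      show "(B has_integral J) {- ((real m + 1 / 2) * h)..(real m + 1 / 2) * h}"
        unfolding B_def J_def R_def using h by (intro has_integral_two_sided_de_weight) simp
      show "norm (g (Complex ((real m + 1 / 2) * h) t)) \<le> \<epsilon> m" if "\<bar>t\<bar> \<le> y" for t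
      proof -
        have "norm (g (Complex (R m) t)) \<le> W \<beta> * de_weight (\<beta> * pi / 2 * cos y) (R m)"
          using gp[of "Complex (R m) t" y] that y Rpos[of m] by (auto simp: W_def)
        also have "\<dots> \<le> \<epsilon> m" unfolding \<epsilon>_def using W[OF \<alpha>] dw[OF \<alpha>] by simp
        finally show ?thesis by (simp add: R_def)
      qed
      show "norm (g (Complex (- ((real m + 1 / 2) * h)) t)) \<le> \<epsilon> m" if "\<bar>t\<bar> \<le> y" for t
      proof -
        have "norm (g (Complex (- R m) t)) \<le> W \<alpha> * de_weight (\<alpha> * pi / 2 * cos y) (R m)"
          using gm[of "Complex (- R m) t" y] that y Rpos[of m] by (auto simp: W_def)
        also have "\<dots> \<le> \<epsilon> m" unfolding \<epsilon>_def using W[OF \<beta>] dw[OF \<beta>] by simp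
        finally show ?thesis by (simp add: R_def)
      qed
    qed
    also have "\<dots> \<le> 2 * (W \<alpha> + W \<beta>) * (q / (1 - q)) + 6 * y * \<epsilon> m"
      using \<open>J \<le> _\<close> q by (intro add_right_mono mult_right_mono) auto
    finally show ?thesis .
  qed
  have trunc: "norm (of_real h * S {- int m..int m} - of_real h * S {-M..N}) \<le> T" if m: "M \<le> int m" "N \<le> int m" for m
  proof -
    define G where "G = (\<lambda>k::int. g (of_real (real_of_int k * h)))"
    \<comment> \<open>The left tail is written as a reflected set, so that both tails run outwards
      and the same estimate applies.\<close>
    have split: "{- int m..int m} = {-M..N} \<union> (uminus ` {M<..M + int (nat (int m - M))} \<union> {N<..N + int (nat (int m - N))})"
      (is "_ = _ \<union> (?L \<union> ?U)")
    proof (intro set_eqI iffI)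
      fix k assume k: "k \<in> {- int m..int m}"
      have "k \<in> ?L" if "k < - M"
        using that k m by (intro image_eqI[of _ _ "- k"]) auto
      then show "k \<in> {-M..N} \<union> (?L \<union> ?U)" using k m by force
    qed (use m M N in auto)
    have "S {- int m..int m} = (\<Sum>k\<in>{-M..N}. G k) + ((\<Sum>k\<in>?L. G k) + (\<Sum>k\<in>?U. G k))"
      unfolding S_def split G_def[symmetric] using M N by (subst sum.union_disjoint, auto)+
    then have "S {- int m..int m} - S {-M..N} = (\<Sum>k\<in>?L. G k) + (\<Sum>k\<in>?U. G k)"
      by (simp add: S_def G_def)
    also have "(\<Sum>k\<in>?L. G k) = (\<Sum>k\<in>{M<..M + int (nat (int m - M))}. G (- k))"
      by (subst sum.reindex) (auto simp: inj_on_def)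
    finally have eq: "S {- int m..int m} - S {-M..N}
      = (\<Sum>k\<in>{M<..M + int (nat (int m - M))}. G (- k)) + (\<Sum>k\<in>?U. G k)" .
    have "h * norm (\<Sum>k\<in>{M<..M + int (nat (int m - M))}. G (- k)) \<le> K * 2 powr \<alpha> / \<alpha> * \<tau>"
    proof (rule norm_sum_int_tail_le[OF h _ _ \<tau>])
      fix k assume "M < k"
      then have "0 < real_of_int k * h" using M h by simp
      then show "norm (G (- k)) \<le> K * 2 powr \<alpha> / \<alpha> * de_weight (\<alpha> * pi / 2) (real_of_int k * h)"
        using gm[of "of_real (real_of_int (- k) * h)" 0] d by (simp add: G_def)
    qed (use K \<alpha> in auto)
    moreover have "h * norm (\<Sum>k\<in>?U. G k) \<le> K * 2 powr \<beta> / \<beta> * \<tau>'"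
    proof (rule norm_sum_int_tail_le[OF h _ _ \<tau>'])
      fix k assume "N < k"
      then have "0 < real_of_int k * h" using N h by simp
      then show "norm (G k) \<le> K * 2 powr \<beta> / \<beta> * de_weight (\<beta> * pi / 2) (real_of_int k * h)"
        using gp[of "of_real (real_of_int k * h)" 0] d by (simp add: G_def)
    qed (use K \<beta> in auto)
    moreover have "norm (of_real h * S {- int m..int m} - of_real h * S {-M..N})
        = h * norm (S {- int m..int m} - S {-M..N})"
      using h by (simp add: norm_mult flip: right_diff_distrib)
    moreover have "h * norm (S {- int m..int m} - S {-M..N})
       \<le> h * (norm (\<Sum>k\<in>{M<..M + int (nat (int m - M))}. G (- k)) + norm (\<Sum>k\<in>?U. G k))"
      unfolding eq using h by (intro mult_left_mono norm_triangle_ineq) auto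
    ultimately show ?thesis unfolding T_def by (simp add: distrib_left)
  qed
  \<comment> \<open>The left side does not depend on \<open>m\<close>; the integral remainder and
    the vertical sides vanish in the limit.\<close>
  have "E \<le> 0 + (2 * (W \<alpha> + W \<beta>) * (q / (1 - q)) + 6 * y * 0) + T"
  proof (rule LIMSEQ_le_const)
    have "(\<lambda>m. norm (I - I' m)) \<longlonglongrightarrow> norm (I - I)" by (intro tendsto_intros I_lim)
    then have "(\<lambda>m. norm (I - I' m)) \<longlonglongrightarrow> 0" by simp
    then show "(\<lambda>m. norm (I - I' m) + (2 * (W \<alpha> + W \<beta>) * (q / (1 - q)) + 6 * y * \<epsilon> m) + T)
        \<longlonglongrightarrow> 0 + (2 * (W \<alpha> + W \<beta>) * (q / (1 - q)) + 6 * y * 0) + T"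
      by (intro tendsto_add tendsto_mult tendsto_const eps_lim)
    have "E \<le> norm (I - I' m) + (2 * (W \<alpha> + W \<beta>) * (q / (1 - q)) + 6 * y * \<epsilon> m) + T"
      if "nat (max M N) \<le> m" for m
    proof -
      have "I - of_real h * S {-M..N} = (I - I' m) + (I' m - of_real h * S {- int m..int m})
          + (of_real h * S {- int m..int m} - of_real h * S {-M..N})" by simp
      then have "E \<le> norm (I - I' m) + norm (I' m - of_real h * S {- int m..int m})
          + norm (of_real h * S {- int m..int m} - of_real h * S {-M..N})"
        unfolding E_def by (metis norm_triangle_mono norm_triangle_ineq order_refl)
      also have "\<dots> \<le> norm (I - I' m) + (2 * (W \<alpha> + W \<beta>) * (q / (1 - q)) + 6 * y * \<epsilon> m) + T"
        using that by (intro add_mono disc trunc order_refl) auto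
      finally show ?thesis .
    qed
    then show "\<exists>n0. \<forall>m\<ge>n0. E \<le> norm (I - I' m) + (2 * (W \<alpha> + W \<beta>) * (q / (1 - q)) + 6 * y * \<epsilon> m) + T" by blast
  qed
  then show ?thesis by (simp add: E_def I_def S_def g_def T_def)
qed

section \<open>Choice of the step size and assembly of the constant\<close>

lemma exp_divide_self_mono:
  fixes u x :: real
  assumes "1 \<le> u" "u \<le> x"
  shows "exp u / u \<le> exp x / x"
proof -
  have "x \<le> (1 + (x - u)) * u"
  proof -
    have "0 \<le> (x - u) * (u - 1)" using assms by simp
    then show ?thesis by (simp add: algebra_simps)
  qed
  also have "\<dots> \<le> exp (x - u) * u" using assms by (intro mult_right_mono) auto
  finally have "exp u * x \<le> exp u * (exp (x - u) * u)" by (intro mult_left_mono) auto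
  also have "\<dots> = exp x * u" by (simp add: exp_diff)
  finally show ?thesis using assms by (simp add: field_simps)
qed

theorem theorem7:
  fixes f :: "complex \<Rightarrow> complex"
    and d K \<alpha> \<beta> \<mu> \<nu> h C1 :: real and n :: nat and M N :: int
  assumes d_pos: "0 < d" and d_lt: "d < pi/2"
    and f_an: "f analytic_on (psi ` strip d)"
    and K_pos: "K > 0" and \<alpha>_pos: "\<alpha> > 0" and \<beta>_pos: "\<beta> > 0"
    and bound_minus: "\<And>z. z \<in> psi ` strip_minus d \<Longrightarrow>
        norm (f z) \<le> K * norm (1 + z^2) powr (-(\<alpha> + 1)/2)"
    and bound_plus: "\<And>z. z \<in> psi ` strip_plus d \<Longrightarrow>
        norm (f z) \<le> K * norm (1 + z^2) powr (-(\<beta> + 1)/2)"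
    and n_pos: "n > 0"
  assumes mu_def: "\<mu> = min \<alpha> \<beta>"
    and nu_def: "\<nu> = max \<alpha> \<beta>"
    and h_def: "h = ln (8 * d * real n / \<mu>) / real n"
  assumes M_def: "M = (if \<mu> = \<alpha> then int n else int n - \<lfloor>ln (\<alpha> / \<beta>) / h\<rfloor>)"
    and N_def: "N = (if \<mu> = \<alpha> then int n - \<lfloor>ln (\<beta> / \<alpha>) / h\<rfloor> else int n)"
  assumes C1_def: "C1 = 2 powr (\<nu> + 1) * K / \<mu> *
      (2 / ((1 - exp (- pi * \<mu> * exp 1 / 4)) * (cos (pi / 2 * sin d)) powr \<nu> * cos d)
       + exp (pi * \<nu> / 4))"
  assumes n_large: "real n \<ge> \<nu> * exp 1 / (8 * d)"
    and M_large: "real_of_int M * h \<ge> xg (\<alpha> / 2)"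
    and N_large: "real_of_int N * h \<ge> xg (\<beta> / 2)"
  shows "norm (integral UNIV (\<lambda>t::real. f (complex_of_real t))
              - complex_of_real h * (\<Sum>k\<in>{-M..N}.
                   f (psi (complex_of_real (real_of_int k * h)))
                   * deriv psi (complex_of_real (real_of_int k * h))))
         \<le> C1 * exp (- 2 * pi * d * real n / ln (8 * d * real n / \<mu>))"
proof -
  define L where "L = ln (8 * d * real n / \<mu>)"
  define Q where "Q = exp (- 2 * pi * d * real n / L)"
  define Q0 where "Q0 = exp (- pi * \<mu> * exp 1 / 4)"
  define c where "c = cos (pi / 2 * sin d)"
  define P where "P = K * 2 powr \<nu> / \<mu>"
  have \<mu>: "0 < \<mu>" "\<mu> \<le> \<alpha>" "\<mu> \<le> \<beta>" and \<nu>: "\<alpha> \<le> \<nu>" "\<beta> \<le> \<nu>" using \<alpha>_pos \<beta>_pos by (auto simp: mu_def nu_def)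
  have n0: "0 < real n" using n_pos by simp
  \<comment> \<open>The largeness condition involves the larger exponent \<nu>, so both logarithms
    are at least 1, where \<open>exp x / x\<close> is increasing.\<close>
  have ge_e: "exp 1 \<le> 8 * d * real n / \<gamma>" if "0 < \<gamma>" "\<gamma> \<le> \<nu>" for \<gamma>
  proof -
    have "\<gamma> * exp 1 \<le> \<nu> * exp 1" using that by simp
    also have "\<dots> \<le> 8 * d * real n" using n_large d_pos by (simp add: field_simps)
    finally show ?thesis using that by (simp add: field_simps)
  qed
  have t0: "0 < 8 * d * real n / \<gamma>" if "0 < \<gamma>" for \<gamma> using that d_pos n0 by simp
  have ln_ge1: "1 \<le> ln (8 * d * real n / \<gamma>)" if "0 < \<gamma>" "\<gamma> \<le> \<nu>" for \<gamma>
    using ge_e[OF that] t0[OF that(1)] by (simp add: ln_ge_iff)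
  have L: "1 \<le> L" unfolding L_def using \<mu> \<nu> by (intro ln_ge1) auto
  have h: "0 < h" using L n0 by (simp add: h_def L_def[symmetric])
  have nh: "real n * h = L" using n0 by (simp add: h_def L_def)
  have Q: "0 < Q" "Q \<le> Q0" and Q0: "Q0 < 1"
  proof -
    \<comment> \<open>The minimum of \<open>exp x / x\<close> on \<open>x \<ge> 1\<close> is
      \<open>exp 1\<close>. This is the origin of \<open>exp 1\<close> in \<open>C1\<close>:
      \<open>Q0\<close> bounds \<open>Q\<close> independently of \<open>n\<close>.\<close>
    have "\<mu> * exp 1 \<le> \<mu> * (exp L / L)" using exp_divide_self_mono[OF _ L] \<mu> by (intro mult_left_mono) auto
    also have "\<dots> = 8 * d * real n / L" using \<mu> t0[OF \<mu>(1)] by (simp add: L_def)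
    finally have "pi / 4 * (\<mu> * exp 1) \<le> pi / 4 * (8 * d * real n / L)" by (intro mult_left_mono) auto
    then show "Q \<le> Q0" by (simp add: Q_def Q0_def algebra_simps)
    show "0 < Q" "Q0 < 1" using \<mu> by (auto simp: Q_def Q0_def)
  qed
  have tail: "h * (\<Sum>j<l. de_weight (\<gamma> * pi / 2) (real_of_int X * h + real (Suc j) * h)) \<le> exp (pi * \<nu> / 4) * Q
      \<and> 0 \<le> X"
    if \<gamma>: "0 < \<gamma>" "\<mu> \<le> \<gamma>" "\<gamma> \<le> \<nu>" and X: "ln (8 * d * real n / \<gamma>) \<le> real_of_int X * h" "xg (\<gamma> / 2) \<le> real_of_int X * h"
    for \<gamma> X l
  proof -
    define u where "u = ln (8 * d * real n / \<gamma>)"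
    define x0 where "x0 = real_of_int X * h"
    have u: "1 \<le> u" unfolding u_def using \<gamma> by (intro ln_ge1)
    have ux: "u \<le> x0" using X by (simp add: u_def x0_def)
    have uL: "u \<le> L" unfolding u_def L_def using \<gamma> \<mu> t0 d_pos n0
      by (subst ln_le_cancel_iff) (auto intro!: divide_left_mono)
    \<comment> \<open>Because of the subtracted floor, \<open>M\<close> and \<open>N\<close> could a
      priori be negative; the tail estimates need the cut to lie on the proper side of 0.\<close>
    have "0 < real_of_int X * h" using u ux by (simp add: x0_def)
    then have "0 \<le> X" using h by (simp add: zero_less_mult_iff)
    have "h * (\<Sum>j<l. de_weight (\<gamma> * pi / 2) (x0 + real (Suc j) * h)) \<le> exp (\<gamma> * pi / 2 / 2 * (1 - exp x0 / x0))"
      using \<gamma> h u ux X(2) by (intro sum_de_weight_le) (auto simp: x0_def)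
    \<comment> \<open>By the choice of \<open>u\<close>, \<open>exp u\<close> equals
      \<open>8 * d * n / \<gamma>\<close>. Hence \<gamma> cancels in the decaying part and both
      sides reach the common rate.\<close>
    also have "\<dots> \<le> exp (pi * \<nu> / 4 + - 2 * pi * d * real n / L)"
    proof -
      have "8 * d * real n / \<gamma> / L \<le> 8 * d * real n / \<gamma> / u"
        using uL u L t0[OF \<gamma>(1)] by (intro divide_left_mono) auto
      also have "\<dots> = exp u / u" using t0[OF \<gamma>(1)] by (simp add: u_def)
      also have "\<dots> \<le> exp x0 / x0" by (rule exp_divide_self_mono[OF u ux])
      finally have "\<gamma> * pi / 4 * (8 * d * real n / \<gamma> / L) \<le> \<gamma> * pi / 4 * (exp x0 / x0)"
        using \<gamma> by (intro mult_left_mono) auto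
      moreover have "\<gamma> * pi / 4 * (8 * d * real n / \<gamma> / L) = 2 * pi * d * real n / L" using \<gamma> by simp
      moreover have "\<gamma> * pi / 4 \<le> pi * \<nu> / 4" using \<gamma> by simp
      moreover have "\<gamma> * pi / 2 / 2 * (1 - exp x0 / x0) = \<gamma> * pi / 4 - \<gamma> * pi / 4 * (exp x0 / x0)"
        unfolding right_diff_distrib by simp
      moreover have "- 2 * pi * d * real n / L = - (2 * pi * d * real n / L)" by simp
      ultimately show ?thesis unfolding exp_le_cancel_iff by linarith
    qed
    also have "\<dots> = exp (pi * \<nu> / 4) * Q" unfolding exp_add Q_def ..
    finally show ?thesis using \<open>0 \<le> X\<close> by (simp add: x0_def)
  qed
  \<comment> \<open>Rounding down removes at most \<open>ln (\<gamma> / \<mu>)\<close> from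
    \<open>n * h = L\<close>, and \<open>L - ln (\<gamma> / \<mu>)\<close> is the required
    cut-off.\<close>
  have shifted: "ln (8 * d * real n / \<gamma>) \<le> real_of_int (int n - \<lfloor>ln (\<gamma> / \<mu>) / h\<rfloor>) * h"
    if "0 < \<gamma>" for \<gamma>
  proof -
    have "real_of_int \<lfloor>ln (\<gamma> / \<mu>) / h\<rfloor> * h \<le> ln (\<gamma> / \<mu>) / h * h" using h by (intro mult_right_mono) auto
    then have "real_of_int \<lfloor>ln (\<gamma> / \<mu>) / h\<rfloor> * h \<le> ln (\<gamma> / \<mu>)" using h by simp
    moreover have "ln (8 * d * real n / \<gamma>) = L - ln (\<gamma> / \<mu>)"
      using that \<mu> d_pos n0 by (simp add: L_def ln_div ln_mult)
    ultimately show ?thesis using nh by (simp add: algebra_simps)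
  qed
  have unshifted: "ln (8 * d * real n / \<mu>) \<le> real_of_int (int n) * h" using nh by (simp add: L_def)
  have lnM: "ln (8 * d * real n / \<alpha>) \<le> real_of_int M * h"
    using shifted[OF \<alpha>_pos] unshifted mu_def by (cases "\<mu> = \<alpha>") (auto simp: M_def min_def split: if_splits)
  have lnN: "ln (8 * d * real n / \<beta>) \<le> real_of_int N * h"
    using shifted[OF \<beta>_pos] unshifted mu_def by (cases "\<mu> = \<alpha>") (auto simp: N_def min_def split: if_splits)
  note tailM = tail[OF \<alpha>_pos \<mu>(2) \<nu>(1) lnM M_large]
  note tailN = tail[OF \<beta>_pos \<mu>(3) \<nu>(2) lnN N_large]
  define E where "E = norm (integral UNIV (\<lambda>t::real. f (complex_of_real t))
              - complex_of_real h * (\<Sum>k\<in>{-M..N}.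
                   f (psi (complex_of_real (real_of_int k * h)))
                   * deriv psi (complex_of_real (real_of_int k * h))))"
  define V where "V = P / (cos d * c powr \<nu>)"
  have P: "0 < P" using K_pos \<mu> by (simp add: P_def)
  have cosd: "0 < cos d" using d_pos d_lt by (intro cos_gt_zero_pi) auto
  have c: "0 < c" "c \<le> 1" using d_pos d_lt cos_half_pi_sin_pos[of d] by (simp_all add: c_def)
  \<comment> \<open>The two sides are merged into one constant: \<mu> in the denominator, \<nu> in
    the power of 2. Since \<open>c \<le> 1\<close>, the larger exponent is also the safe one for the
    power of \<open>c\<close> in \<open>V\<close>.\<close>
  have Pge: "K * 2 powr \<gamma> / \<gamma> \<le> P" if "\<mu> \<le> \<gamma>" "\<gamma> \<le> \<nu>" for \<gamma>
    unfolding P_def using that \<mu> K_pos by (intro frac_le mult_left_mono powr_mono) auto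
  have V: "0 < V" using P cosd c by (simp add: V_def)
  have Wle: "K * 2 powr \<gamma> / (\<gamma> * cos y * cos (pi / 2 * sin y) powr \<gamma>) \<le> V"
    if "\<mu> \<le> \<gamma>" "\<gamma> \<le> \<nu>" "0 < y" "y < d" for \<gamma> y
  proof -
    have "cos d \<le> cos y" using that d_lt by (intro cos_monotone_0_pi_le) auto
    have "c powr \<nu> \<le> c powr \<gamma>" using c that by (intro powr_mono') auto
    also have "\<dots> \<le> cos (pi / 2 * sin y) powr \<gamma>"
      using c that d_lt \<mu> unfolding c_def by (intro powr_mono2 cos_half_pi_sin_antimono) auto
    finally have "c powr \<nu> \<le> cos (pi / 2 * sin y) powr \<gamma>" .
    then have "cos d * c powr \<nu> \<le> cos y * cos (pi / 2 * sin y) powr \<gamma>"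
      using \<open>cos d \<le> cos y\<close> cosd by (intro mult_mono) auto
    then have "(K * 2 powr \<gamma> / \<gamma>) / (cos y * cos (pi / 2 * sin y) powr \<gamma>) \<le> V"
      unfolding V_def using P cosd c Pge[OF that(1,2)] by (intro frac_le) auto
    then show ?thesis by (simp add: mult.assoc)
  qed
  have bound: "E \<le> 4 * V * (exp (- (2 * pi * y / h)) / (1 - exp (- (2 * pi * y / h)))) + 2 * P * (exp (pi * \<nu> / 4) * Q)"
    if y: "0 < y" "y < d" for y
  proof -
    let ?q = "exp (- (2 * pi * y / h))"
    have "E \<le> 2 * (K * 2 powr \<alpha> / (\<alpha> * cos y * cos (pi / 2 * sin y) powr \<alpha>)
          + K * 2 powr \<beta> / (\<beta> * cos y * cos (pi / 2 * sin y) powr \<beta>)) * (?q / (1 - ?q))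
        + K * 2 powr \<alpha> / \<alpha> * (exp (pi * \<nu> / 4) * Q) + K * 2 powr \<beta> / \<beta> * (exp (pi * \<nu> / 4) * Q)"
      unfolding E_def
      by (rule de_quadrature_error_le[OF d_pos d_lt f_an K_pos \<alpha>_pos \<beta>_pos bound_minus bound_plus h y
            tailM[THEN conjunct2] tailN[THEN conjunct2] tailM[THEN conjunct1] tailN[THEN conjunct1]])
    also have "\<dots> \<le> 2 * (V + V) * (?q / (1 - ?q)) + P * (exp (pi * \<nu> / 4) * Q) + P * (exp (pi * \<nu> / 4) * Q)"
      using Wle[of _ y] Pge \<mu> \<nu> y h Q by (intro add_mono mult_right_mono mult_left_mono) auto
    finally show ?thesis by (simp add: algebra_simps)
  qed
  have "2 * pi * d / h = 2 * pi * d * real n / L" using n0 by (simp add: h_def L_def[symmetric])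
  then have Qh: "Q = exp (- (2 * pi * d / h))" by (simp add: Q_def)
  \<comment> \<open>The bound \<open>V\<close> no longer depends on \<open>y\<close>, so only the
    exponentials vary as \<open>y\<close> tends to \<open>d\<close> from the left.\<close>
  have "E \<le> 4 * V * (Q / (1 - Q)) + 2 * P * (exp (pi * \<nu> / 4) * Q)"
  proof (rule tendsto_lowerbound)
    show "((\<lambda>y. 4 * V * (exp (- (2 * pi * y / h)) / (1 - exp (- (2 * pi * y / h)))) + 2 * P * (exp (pi * \<nu> / 4) * Q))
        \<longlongrightarrow> 4 * V * (Q / (1 - Q)) + 2 * P * (exp (pi * \<nu> / 4) * Q)) (at_left d)"
      unfolding Qh using h d_pos by (intro tendsto_intros) auto
    show "\<forall>\<^sub>F y in at_left d. E \<le> 4 * V * (exp (- (2 * pi * y / h)) / (1 - exp (- (2 * pi * y / h)))) + 2 * P * (exp (pi * \<nu> / 4) * Q)"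
      using eventually_at_left_real[OF d_pos] by eventually_elim (rule bound; simp)
  qed simp
  \<comment> \<open>Only the denominator is weakened to \<open>Q0\<close>; the numerator keeps the
    convergence rate.\<close>
  also have "\<dots> \<le> 4 * V * (Q / (1 - Q0)) + 2 * P * (exp (pi * \<nu> / 4) * Q)"
    using V Q Q0 by (intro add_right_mono mult_left_mono divide_left_mono) auto
  also have "\<dots> = C1 * Q"
  proof -
    have "2 powr (\<nu> + 1) * K / \<mu> = 2 * P" by (simp add: P_def powr_add)
    then have "C1 = 2 * P * (2 / ((1 - Q0) * c powr \<nu> * cos d) + exp (pi * \<nu> / 4))"
      unfolding C1_def Q0_def c_def by (simp only:)
    moreover have "4 * V * (Q / (1 - Q0)) = 2 * P * (2 / ((1 - Q0) * c powr \<nu> * cos d)) * Q"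
      by (simp add: V_def mult_ac)
    ultimately show ?thesis by (simp only: distrib_left distrib_right mult.assoc)
  qed
  finally show ?thesis by (simp add: E_def Q_def L_def)
qed

end
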